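(* Let $A$ be a strong pseudo-amenable Banach algebra. Then $A$ is pseudo-amenable.
   Context: For a (complex) Banach algebra $A$, $A\otimes_p A$ is the projective tensor product, a Banach $A$-bimodule via $a\cdot(b\otimes c)=ab\otimes c$, $(b\otimes c)\cdot a=b\otimes ca$; $\pi_A:A\otimes_pA\to A$ is the bounded linear map with $\pi_A(a\otimes b)=ab$. For a Banach $A$-bimodule $X$, $X^*$ is a Banach $A$-bimodule via $(a\cdot f)(x)=f(x\cdot a)$, $(f\cdot a)(x)=f(a\cdot x)$; iterating, $(A\otimes_pA)^{**}$ and $A^{**}$ are Banach $A$-bimodules, and $A\subseteq A^{**}$ canonically. $A$ is strong pseudo-amenable if there is a (not necessarily bounded) net $(m_\alpha)$ in $(A\otimes_pA)^{**}$ such that for every $a\in A$: $a\cdot m_\alpha-m_\alpha\cdot a\to 0$ in norm, $a\,\pi_A^{**}(m_\alpha)=\pi_A^{**}(m_\alpha)\,a$ for all $\alpha$, and $\pi_A^{**}(m_\alpha)\,a\to a$ in norm. $A$ is pseudo-amenable if there is a (not necessarily bounded) net $(m_\alpha)$ in $A\otimes_pA$ with $a\cdot m_\alpha-m_\alpha\cdot a\to0$ and $\pi_A(m_\alpha)a\to a$ in norm for every $a\in A$. *)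

theory Defs
  imports "HOL-Analysis.Analysis"
begin

section \<open>Complex Banach spaces and Banach algebras\<close>

class complex_vector = real_vector +
  fixes scaleC :: "complex \<Rightarrow> 'a \<Rightarrow> 'a"  (infixr "*\<^sub>C" 75)
  assumes scaleC_add_right: "c *\<^sub>C (x + y) = c *\<^sub>C x + c *\<^sub>C y"
    and scaleC_add_left: "(c + d) *\<^sub>C x = c *\<^sub>C x + d *\<^sub>C x"
    and scaleC_scaleC: "c *\<^sub>C (d *\<^sub>C x) = (c * d) *\<^sub>C x"
    and scaleR_scaleC: "r *\<^sub>R x = complex_of_real r *\<^sub>C x"

lemma scaleC_one [simp]: "1 *\<^sub>C x = (x :: 'a::complex_vector)"
  using scaleR_scaleC[of 1 x] by simp

lemma scaleC_zero_left [simp]: "0 *\<^sub>C x = (0 :: 'a::complex_vector)"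
  using scaleR_scaleC[of 0 x] by simp

lemma scaleC_zero_right [simp]: "c *\<^sub>C 0 = (0 :: 'a::complex_vector)"
  using scaleC_add_right[of c "0::'a" 0] by simp

lemma scaleC_minus_one: "(- 1) *\<^sub>C x = - (x :: 'a::complex_vector)"
  using scaleR_scaleC[of "- 1" x] by simp

lemma scaleC_minus_right: "c *\<^sub>C (- x) = - (c *\<^sub>C (x :: 'a::complex_vector))"
  using scaleC_add_right[of c x "- x"] by (simp add: eq_neg_iff_add_eq_0 add.commute)

lemma scaleC_diff_right: "c *\<^sub>C (x - y) = c *\<^sub>C x - c *\<^sub>C (y :: 'a::complex_vector)"
  using scaleC_add_right[of c x "- y"] by (simp add: scaleC_minus_right)

class complex_normed_vector = complex_vector + real_normed_vector +
  assumes norm_scaleC: "norm (c *\<^sub>C x) = cmod c * norm x"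

class complex_banach = complex_normed_vector + banach

text \<open>Banach algebras are complex and not assumed to be unital.\<close>

class complex_banach_algebra = complex_banach + real_normed_algebra +
  assumes mult_scaleC_left: "(c *\<^sub>C x) * y = c *\<^sub>C (x * y)"
    and mult_scaleC_right: "x * (c *\<^sub>C y) = c *\<^sub>C (x * y)"

instantiation complex :: complex_banach_algebra
begin

definition scaleC_complex :: "complex \<Rightarrow> complex \<Rightarrow> complex"
  where "scaleC_complex c x = c * x"

instance
  by standard (auto simp: scaleC_complex_def algebra_simps norm_mult scaleR_conv_of_real)

end


section \<open>Dual spaces and adjoints\<close>

definition bounded_clinear :: "('x::complex_normed_vector \<Rightarrow> 'y::complex_normed_vector) \<Rightarrow> bool"
  where "bounded_clinear f \<longleftrightarrow> bounded_linear f \<and> (\<forall>c x. f (c *\<^sub>C x) = c *\<^sub>C f x)"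

typedef (overloaded) 'x dual = "{f :: 'x::complex_normed_vector \<Rightarrow> complex. bounded_clinear f}"
  morphisms dual_apply Dual
  by (rule exI[of _ "\<lambda>x. 0"]) (simp add: bounded_clinear_def)

setup_lifting type_definition_dual

lemma onorm_cmult: "bounded_linear f \<Longrightarrow> onorm (\<lambda>x. c * f x) = cmod c * onorm f"
  for f :: "'a::real_normed_vector \<Rightarrow> complex"
proof (rule antisym)
  assume f: "bounded_linear f"
  have le: "onorm (\<lambda>x. d * g x) \<le> cmod d * onorm g" if "bounded_linear g"
    for d and g :: "'a \<Rightarrow> complex"
    using that onorm[OF that] onorm_pos_le[OF that]
    by (auto intro!: onorm_bound simp: norm_mult mult.assoc mult_left_mono)
  show "onorm (\<lambda>x. c * f x) \<le> cmod c * onorm f"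
    by (rule le[OF f])
  show "cmod c * onorm f \<le> onorm (\<lambda>x. c * f x)"
  proof (cases "c = 0")
    case True
    then show ?thesis by (simp add: onorm_zero)
  next
    case False
    have "bounded_linear (\<lambda>x. c * f x)"
      by (rule bounded_linear_compose[OF bounded_linear_mult_right f])
    from le[OF this, of "inverse c"] False show ?thesis
      by (simp add: norm_divide divide_simps mult.commute)
  qed
qed

instantiation dual :: (complex_normed_vector) complex_normed_vector
begin

lift_definition norm_dual :: "'a dual \<Rightarrow> real" is onorm .

lift_definition minus_dual :: "'a dual \<Rightarrow> 'a dual \<Rightarrow> 'a dual" is "\<lambda>f g x. f x - g x"
  by (auto simp: bounded_clinear_def scaleC_complex_def algebra_simps intro: bounded_linear_sub)

lift_definition uminus_dual :: "'a dual \<Rightarrow> 'a dual" is "\<lambda>f x. - f x"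
  by (auto simp: bounded_clinear_def scaleC_complex_def intro: bounded_linear_minus)

lift_definition zero_dual :: "'a dual" is "\<lambda>x. 0"
  by (simp add: bounded_clinear_def)

lift_definition plus_dual :: "'a dual \<Rightarrow> 'a dual \<Rightarrow> 'a dual" is "\<lambda>f g x. f x + g x"
  by (auto simp: bounded_clinear_def scaleC_complex_def algebra_simps intro: bounded_linear_add)

lift_definition scaleR_dual :: "real \<Rightarrow> 'a dual \<Rightarrow> 'a dual" is "\<lambda>r f x. r *\<^sub>R f x"
  by (auto simp: bounded_clinear_def scaleC_complex_def algebra_simps
      intro: bounded_linear_compose[OF bounded_linear_scaleR_right])

lift_definition scaleC_dual :: "complex \<Rightarrow> 'a dual \<Rightarrow> 'a dual" is "\<lambda>c f x. c * f x"
  by (auto simp: bounded_clinear_def scaleC_complex_def algebra_simps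
      intro: bounded_linear_compose[OF bounded_linear_mult_right])

definition dist_dual :: "'a dual \<Rightarrow> 'a dual \<Rightarrow> real"
  where "dist_dual f g = norm (f - g)"

definition uniformity_dual :: "('a dual \<times> 'a dual) filter"
  where "uniformity_dual = (INF e\<in>{0 <..}. principal {(x, y). dist x y < e})"

definition open_dual :: "'a dual set \<Rightarrow> bool"
  where "open_dual S = (\<forall>x\<in>S. \<forall>\<^sub>F (x', y) in uniformity. x' = x \<longrightarrow> y \<in> S)"

definition sgn_dual :: "'a dual \<Rightarrow> 'a dual"
  where "sgn_dual x = scaleR (inverse (norm x)) x"

instance
proof
  fix f g h :: "'a dual" and c d :: complex and r s :: real
  show "f + g + h = f + (g + h)" "f + g = g + f" "0 + f = f" "- f + f = 0" "f - g = f + - g"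
    by (transfer, simp add: fun_eq_iff algebra_simps)+
  show "r *\<^sub>R (f + g) = r *\<^sub>R f + r *\<^sub>R g" "(r + s) *\<^sub>R f = r *\<^sub>R f + s *\<^sub>R f"
    "r *\<^sub>R s *\<^sub>R f = (r * s) *\<^sub>R f" "1 *\<^sub>R f = f"
    by (transfer, simp add: fun_eq_iff algebra_simps)+
  show "c *\<^sub>C (f + g) = c *\<^sub>C f + c *\<^sub>C g" "(c + d) *\<^sub>C f = c *\<^sub>C f + d *\<^sub>C f"
    "c *\<^sub>C d *\<^sub>C f = (c * d) *\<^sub>C f"
    by (transfer, simp add: fun_eq_iff algebra_simps)+
  show "r *\<^sub>R f = complex_of_real r *\<^sub>C f"
    by (transfer, simp add: fun_eq_iff scaleR_conv_of_real)
  show "norm f = 0 \<longleftrightarrow> f = 0"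
    by (transfer, simp add: bounded_clinear_def onorm_eq_0 fun_eq_iff)
  show "norm (f + g) \<le> norm f + norm g"
    by (transfer, simp add: bounded_clinear_def onorm_triangle)
  show "norm (r *\<^sub>R f) = \<bar>r\<bar> * norm f"
    by (transfer, simp add: bounded_clinear_def onorm_scaleR)
  show "norm (c *\<^sub>C f) = cmod c * norm f"
    by (transfer, simp add: bounded_clinear_def onorm_cmult)
qed (simp_all only: dist_dual_def sgn_dual_def uniformity_dual_def open_dual_def)

end

lemma dual_eqI: "(\<And>x. dual_apply f x = dual_apply g x) \<Longrightarrow> f = g"
  by transfer auto

lemma bounded_clinear_dual_apply: "bounded_clinear (dual_apply f)"
  using dual_apply by blast

text \<open>The adjoint \<open>T\<^sup>*\<close> of a bounded linear map; it is meaningless if \<open>T\<close> is not bounded.\<close>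

definition adjoint :: "('x::complex_normed_vector \<Rightarrow> 'y::complex_normed_vector) \<Rightarrow> 'y dual \<Rightarrow> 'x dual"
  where "adjoint T f = Dual (\<lambda>x. dual_apply f (T x))"

definition canonical_embedding :: "'x::complex_normed_vector \<Rightarrow> 'x dual dual"
  where "canonical_embedding x = Dual (\<lambda>f. dual_apply f x)"

lemma bounded_clinear_compose:
  "bounded_clinear f \<Longrightarrow> bounded_clinear g \<Longrightarrow> bounded_clinear (\<lambda>x. f (g x))"
  by (auto simp: bounded_clinear_def intro: bounded_linear_compose)

lemma dual_apply_adjoint:
  assumes "bounded_clinear T"
  shows "dual_apply (adjoint T f) x = dual_apply f (T x)"
  unfolding adjoint_def
  by (subst Dual_inverse) (auto intro: bounded_clinear_compose bounded_clinear_dual_apply assms)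

lemma norm_dual_apply_le: "cmod (dual_apply f x) \<le> norm f * norm x"
  by transfer (auto simp: bounded_clinear_def intro: onorm)

lemma norm_dual_bound: "0 \<le> b \<Longrightarrow> (\<And>x. cmod (dual_apply f x) \<le> b * norm x) \<Longrightarrow> norm f \<le> b"
  by transfer (rule onorm_bound)

lemma bounded_clinear_adjoint:
  assumes "bounded_clinear T"
  shows "bounded_clinear (adjoint T)"
proof -
  obtain K where K: "0 \<le> K" "\<And>x. norm (T x) \<le> norm x * K"
    using assms bounded_linear.nonneg_bounded unfolding bounded_clinear_def by blast
  have "norm (adjoint T f) \<le> norm f * K" for f
  proof (rule norm_dual_bound)
    fix x
    have "cmod (dual_apply (adjoint T f) x) \<le> norm f * norm (T x)"
      by (simp add: dual_apply_adjoint assms norm_dual_apply_le)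
    also have "\<dots> \<le> norm f * (norm x * K)"
      by (intro mult_left_mono K) simp
    finally show "cmod (dual_apply (adjoint T f) x) \<le> norm f * K * norm x"
      by (simp add: ac_simps)
  qed (use K in simp)
  then have "bounded_linear (adjoint T)"
    by (intro bounded_linear_intro[where K=K] dual_eqI)
      (auto simp: dual_apply_adjoint[OF assms] plus_dual.rep_eq scaleR_dual.rep_eq)
  then show ?thesis
    by (auto simp: bounded_clinear_def intro!: dual_eqI
        simp: dual_apply_adjoint[OF assms] scaleC_dual.rep_eq)
qed

lemma dual_apply_canonical_embedding:
  "dual_apply (canonical_embedding x) f = dual_apply f x"
proof -
  have "bounded_clinear (\<lambda>f. dual_apply f x)"
    unfolding bounded_clinear_def
    by (auto intro!: bounded_linear_intro[where K="norm x"]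
        simp: plus_dual.rep_eq scaleR_dual.rep_eq scaleC_dual.rep_eq scaleC_complex_def norm_dual_apply_le)
  then show ?thesis
    by (simp add: canonical_embedding_def Dual_inverse)
qed


section \<open>Dual bimodules\<close>

text \<open>
  A bimodule structure on \<open>X\<close> is given by its left action \<open>l\<close> and its right action \<open>r\<close>, where
  \<open>l a x\<close> stands for \<open>a \<cdot> x\<close> and \<open>r a x\<close> for \<open>x \<cdot> a\<close>. As \<open>(a \<cdot> f)(x) = f(x \<cdot> a)\<close> and
  \<open>(f \<cdot> a)(x) = f(a \<cdot> x)\<close>, the left action on \<open>X\<^sup>*\<close> is the adjoint of the right action on \<open>X\<close>,
  and vice versa.
\<close>

definition dual_left :: "('a \<Rightarrow> 'x \<Rightarrow> 'x) \<Rightarrow> 'a \<Rightarrow> 'x::complex_normed_vector dual \<Rightarrow> 'x dual"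
  where "dual_left r a = adjoint (r a)"

definition dual_right :: "('a \<Rightarrow> 'x \<Rightarrow> 'x) \<Rightarrow> 'a \<Rightarrow> 'x::complex_normed_vector dual \<Rightarrow> 'x dual"
  where "dual_right l a = adjoint (l a)"

definition bidual_left :: "('a \<Rightarrow> 'x \<Rightarrow> 'x) \<Rightarrow> 'a \<Rightarrow> 'x::complex_normed_vector dual dual \<Rightarrow> 'x dual dual"
  where "bidual_left l = dual_left (dual_right l)"

definition bidual_right :: "('a \<Rightarrow> 'x \<Rightarrow> 'x) \<Rightarrow> 'a \<Rightarrow> 'x::complex_normed_vector dual dual \<Rightarrow> 'x dual dual"
  where "bidual_right r = dual_right (dual_left r)"


section \<open>The algebraic tensor product\<close>

text \<open>
  The list \<open>[(a\<^sub>1, b\<^sub>1), \<dots>, (a\<^sub>n, b\<^sub>n)]\<close> stands for \<open>a\<^sub>1 \<otimes> b\<^sub>1 + \<dots> + a\<^sub>n \<otimes> b\<^sub>n\<close>; two lists represent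
  the same tensor iff they are related by the congruence generated by the bilinearity relations.
\<close>

inductive tensor_eq :: "('a::complex_vector \<times> 'b::complex_vector) list \<Rightarrow> ('a \<times> 'b) list \<Rightarrow> bool" where
  refl: "tensor_eq xs xs"
| sym: "tensor_eq xs ys \<Longrightarrow> tensor_eq ys xs"
| trans: "tensor_eq xs ys \<Longrightarrow> tensor_eq ys zs \<Longrightarrow> tensor_eq xs zs"
| append: "tensor_eq xs xs' \<Longrightarrow> tensor_eq ys ys' \<Longrightarrow> tensor_eq (xs @ ys) (xs' @ ys')"
| commute: "tensor_eq (xs @ ys) (ys @ xs)"
| zero: "tensor_eq [(0, b)] []"
| add_left: "tensor_eq [(a + a', b)] [(a, b), (a', b)]"
| add_right: "tensor_eq [(a, b + b')] [(a, b), (a, b')]"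
| scale: "tensor_eq [(c *\<^sub>C a, b)] [(a, c *\<^sub>C b)]"

quotient_type (overloaded) ('a, 'b) alg_tensor =
  "('a::complex_vector \<times> 'b::complex_vector) list" / tensor_eq
  by (intro equivpI reflpI sympI transpI) (blast intro: tensor_eq.intros)+

lemma tensor_eq_Cons: "tensor_eq xs ys \<Longrightarrow> tensor_eq (p # xs) (p # ys)"
  using tensor_eq.append[OF tensor_eq.refl[of "[p]"]] by simp

lemma tensor_eq_swap: "tensor_eq (xs @ ys @ zs) (ys @ xs @ zs)"
  using tensor_eq.append[OF tensor_eq.commute tensor_eq.refl[of zs]] by fastforce

lemma tensor_eq_map:
  assumes "tensor_eq xs ys"
    and f: "\<And>x y. f (x + y) = f x + f y" "\<And>c x. f (c *\<^sub>C x) = c *\<^sub>C f x"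
    and g: "\<And>x y. g (x + y) = g x + g y" "\<And>c x. g (c *\<^sub>C x) = c *\<^sub>C g x"
  shows "tensor_eq (map (map_prod f g) xs) (map (map_prod f g) ys)"
  using assms(1)
proof induction
  case (zero b)
  have "f 0 = 0"
    using f(1)[of 0 0] by simp
  then show ?case by (simp add: tensor_eq.zero)
qed (auto simp: f g intro: tensor_eq.intros)

lemma tensor_eq_map_add:
  assumes f: "\<And>x. f x = g x + h x"
  shows "tensor_eq (map (map_prod f id) xs) (map (map_prod g id) xs @ map (map_prod h id) xs)"
proof (induction xs)
  case Nil
  then show ?case by (simp add: tensor_eq.refl)
next
  case (Cons p xs)
  obtain a b where p: "p = (a, b)" by force
  let ?G = "map (map_prod g id) xs" and ?H = "map (map_prod h id) xs"
  have "tensor_eq ([(f a, b)] @ map (map_prod f id) xs) ([(g a, b), (h a, b)] @ (?G @ ?H))"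
    by (intro tensor_eq.append Cons.IH) (simp add: f tensor_eq.add_left)
  also have "\<dots> = (g a, b) # ([(h a, b)] @ ?G @ ?H)" by simp
  finally have 1: "tensor_eq ([(f a, b)] @ map (map_prod f id) xs) \<dots>" .
  have 2: "tensor_eq \<dots> ((g a, b) # (?G @ [(h a, b)] @ ?H))"
    by (intro tensor_eq_Cons tensor_eq_swap)
  from tensor_eq.trans[OF 1 2] show ?case by (simp add: p id_def)
qed

lemma tensor_eq_map_zero: "tensor_eq (map (map_prod (\<lambda>_. 0) id) xs) []"
proof (induction xs)
  case (Cons p xs)
  from tensor_eq.append[OF tensor_eq.zero[of "snd p"] Cons.IH] show ?case
    by (cases p) simp
qed (simp add: tensor_eq.refl)

instantiation alg_tensor :: (complex_vector, complex_vector) complex_vector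
begin

lift_definition zero_alg_tensor :: "('a, 'b) alg_tensor" is "[]" .

lift_definition plus_alg_tensor :: "('a, 'b) alg_tensor \<Rightarrow> ('a, 'b) alg_tensor \<Rightarrow> ('a, 'b) alg_tensor"
  is "(@)" by (rule tensor_eq.append)

lift_definition scaleC_alg_tensor :: "complex \<Rightarrow> ('a, 'b) alg_tensor \<Rightarrow> ('a, 'b) alg_tensor"
  is "\<lambda>c. map (map_prod ((*\<^sub>C) c) id)"
  by (erule tensor_eq_map) (simp_all add: scaleC_add_right scaleC_scaleC mult.commute)

lift_definition uminus_alg_tensor :: "('a, 'b) alg_tensor \<Rightarrow> ('a, 'b) alg_tensor"
  is "map (map_prod uminus id)"
  by (erule tensor_eq_map) (simp_all add: scaleC_minus_right)

definition minus_alg_tensor :: "('a, 'b) alg_tensor \<Rightarrow> ('a, 'b) alg_tensor \<Rightarrow> ('a, 'b) alg_tensor"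
  where "minus_alg_tensor u v = u + - v"

definition scaleR_alg_tensor :: "real \<Rightarrow> ('a, 'b) alg_tensor \<Rightarrow> ('a, 'b) alg_tensor"
  where "scaleR_alg_tensor r u = complex_of_real r *\<^sub>C u"

instance
proof
  fix u v w :: "('a, 'b) alg_tensor" and c d :: complex and r s :: real
  have sC: "c *\<^sub>C (u + v) = c *\<^sub>C u + c *\<^sub>C v" for c and u v :: "('a, 'b) alg_tensor"
    by transfer (simp add: tensor_eq.refl)
  have sC2: "(c + d) *\<^sub>C u = c *\<^sub>C u + d *\<^sub>C u" for c d and u :: "('a, 'b) alg_tensor"
    by transfer (rule tensor_eq_map_add, rule scaleC_add_left)
  have sC3: "c *\<^sub>C (d *\<^sub>C u) = (c * d) *\<^sub>C u" for c d and u :: "('a, 'b) alg_tensor"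
    by transfer (simp add: tensor_eq.refl scaleC_scaleC comp_def map_prod_def case_prod_beta')
  have sC1: "1 *\<^sub>C u = u" for u :: "('a, 'b) alg_tensor"
    by transfer (simp add: tensor_eq.refl map_prod_def case_prod_beta')
  show "u + v + w = u + (v + w)"
    by transfer (simp add: tensor_eq.refl)
  show "u + v = v + u"
    by transfer (rule tensor_eq.commute)
  show "0 + u = u"
    by transfer (simp add: tensor_eq.refl)
  show "- u + u = 0"
  proof transfer
    fix xs :: "('a \<times> 'b) list"
    have "tensor_eq (map (map_prod (\<lambda>_. 0) id) xs)
        (map (map_prod uminus id) xs @ map (map_prod id id) xs)"
      by (rule tensor_eq_map_add) simp
    from tensor_eq.trans[OF tensor_eq.sym[OF this] tensor_eq_map_zero]
    show "tensor_eq (map (map_prod uminus id) xs @ xs) []"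
      by (simp add: map_prod.id)
  qed
  show "u - v = u + - v"
    by (simp add: minus_alg_tensor_def)
  show "c *\<^sub>C (u + v) = c *\<^sub>C u + c *\<^sub>C v" by (rule sC)
  show "(c + d) *\<^sub>C u = c *\<^sub>C u + d *\<^sub>C u" by (rule sC2)
  show "c *\<^sub>C d *\<^sub>C u = (c * d) *\<^sub>C u" by (rule sC3)
  show "r *\<^sub>R u = complex_of_real r *\<^sub>C u" by (rule scaleR_alg_tensor_def)
  show "r *\<^sub>R (u + v) = r *\<^sub>R u + r *\<^sub>R v"
    by (simp add: scaleR_alg_tensor_def sC)
  show "(r + s) *\<^sub>R u = r *\<^sub>R u + s *\<^sub>R u"
    by (simp add: scaleR_alg_tensor_def sC2)
  show "r *\<^sub>R s *\<^sub>R u = (r * s) *\<^sub>R u"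
    by (simp add: scaleR_alg_tensor_def sC3)
  show "1 *\<^sub>R u = u"
    by (simp add: scaleR_alg_tensor_def sC1)
qed

end

lift_definition alg_tens :: "'a::complex_vector \<Rightarrow> 'b::complex_vector \<Rightarrow> ('a, 'b) alg_tensor"
  is "\<lambda>a b. [(a, b)]" .

definition tensor_sum :: "('a::complex_vector \<times> 'b::complex_vector) list \<Rightarrow> ('a, 'b) alg_tensor"
  where "tensor_sum xs = (\<Sum>(a, b)\<leftarrow>xs. alg_tens a b)"

lemma tensor_sum_simps [simp]:
  "tensor_sum [] = 0"
  "tensor_sum (p # xs) = alg_tens (fst p) (snd p) + tensor_sum xs"
  "tensor_sum (xs @ ys) = tensor_sum xs + tensor_sum ys"
  by (simp_all add: tensor_sum_def case_prod_beta)

lemma abs_alg_tensor_eq: "abs_alg_tensor xs = tensor_sum xs"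
proof (induction xs)
  case Nil
  then show ?case by (simp add: zero_alg_tensor.abs_eq)
next
  case (Cons p xs)
  have "abs_alg_tensor (p # xs) = abs_alg_tensor [p] + abs_alg_tensor xs"
    by (simp add: plus_alg_tensor.abs_eq)
  then show ?case
    by (simp add: Cons.IH alg_tens.abs_eq)
qed

lemma alg_tensor_cases: obtains xs where "u = tensor_sum xs"
  by (metis abs_alg_tensor_eq Quotient_rep_abs Quotient_alg_tensor Quotient_abs_rep)


lift_definition alg_left :: "'a \<Rightarrow> ('a::complex_banach_algebra, 'a) alg_tensor \<Rightarrow> ('a, 'a) alg_tensor"
  is "\<lambda>a. map (map_prod (\<lambda>b. a * b) id)"
  by (erule tensor_eq_map) (simp_all add: distrib_left mult_scaleC_right)

lift_definition alg_right :: "'a \<Rightarrow> ('a::complex_banach_algebra, 'a) alg_tensor \<Rightarrow> ('a, 'a) alg_tensor"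
  is "\<lambda>a. map (map_prod id (\<lambda>c. c * a))"
  by (erule tensor_eq_map) (simp_all add: distrib_right mult_scaleC_left)

lift_definition alg_mult :: "('a::complex_banach_algebra, 'a) alg_tensor \<Rightarrow> 'a"
  is "\<lambda>xs. \<Sum>(a, b)\<leftarrow>xs. a * b"
  by (erule tensor_eq.induct) (simp_all add: algebra_simps mult_scaleC_left mult_scaleC_right)

lemma alg_left_add: "alg_left a (u + v) = alg_left a u + alg_left a v"
  by transfer (simp add: tensor_eq.refl)

lemma alg_right_add: "alg_right a (u + v) = alg_right a u + alg_right a v"
  by transfer (simp add: tensor_eq.refl)

lemma alg_mult_add: "alg_mult (u + v) = alg_mult u + alg_mult v"
  by transfer simp

lemma alg_left_diff: "alg_left a (u - v) = alg_left a u - alg_left a v"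
  using alg_left_add[of a "u - v" v] by (simp add: algebra_simps)

lemma alg_right_diff: "alg_right a (u - v) = alg_right a u - alg_right a v"
  using alg_right_add[of a "u - v" v] by (simp add: algebra_simps)

lemma alg_mult_diff: "alg_mult (u - v) = alg_mult u - alg_mult v"
  using alg_mult_add[of "u - v" v] by (simp add: algebra_simps)

lemma alg_left_scaleC: "alg_left a (c *\<^sub>C u) = c *\<^sub>C alg_left a u"
  by transfer (simp add: tensor_eq.refl comp_def map_prod_def case_prod_beta mult_scaleC_right)

lemma alg_right_scaleC: "alg_right a (c *\<^sub>C u) = c *\<^sub>C alg_right a u"
  by transfer (simp add: tensor_eq.refl comp_def map_prod_def case_prod_beta)

lemma alg_mult_tensor_sum: "alg_mult (tensor_sum xs) = (\<Sum>(a, b)\<leftarrow>xs. a * b)"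
  unfolding abs_alg_tensor_eq[symmetric] by (rule alg_mult.abs_eq)

lemma scaleC_sum_list: "c *\<^sub>C (\<Sum>x\<leftarrow>xs. f x) = (\<Sum>x\<leftarrow>xs. c *\<^sub>C (f x :: 'a::complex_vector))"
  by (induction xs) (simp_all add: scaleC_add_right)

lemma alg_mult_scaleC: "alg_mult (c *\<^sub>C u) = c *\<^sub>C alg_mult u"
  by transfer (simp add: scaleC_sum_list o_def case_prod_beta mult_scaleC_left)

lemma alg_left_alg_tens: "alg_left a (alg_tens b c) = alg_tens (a * b) c"
  by transfer (simp add: tensor_eq.refl)

lemma alg_right_alg_tens: "alg_right a (alg_tens b c) = alg_tens b (c * a)"
  by transfer (simp add: tensor_eq.refl)

lemma alg_mult_alg_tens: "alg_mult (alg_tens a b) = a * b"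
  by transfer simp

lifting_forget alg_tensor.lifting


section \<open>The projective tensor product\<close>

definition proj_norm :: "('a::complex_normed_vector, 'b::complex_normed_vector) alg_tensor \<Rightarrow> real"
  where "proj_norm u = Inf {\<Sum>(a, b)\<leftarrow>xs. norm a * norm b | xs. u = (\<Sum>(a, b)\<leftarrow>xs. alg_tens a b)}"

definition tensor_cost :: "('a::complex_normed_vector \<times> 'b::complex_normed_vector) list \<Rightarrow> real"
  where "tensor_cost xs = (\<Sum>(a, b)\<leftarrow>xs. norm a * norm b)"

lemma tensor_cost_simps [simp]:
  "tensor_cost [] = 0"
  "tensor_cost (p # xs) = norm (fst p) * norm (snd p) + tensor_cost xs"
  "tensor_cost (xs @ ys) = tensor_cost xs + tensor_cost ys"
  by (simp_all add: tensor_cost_def case_prod_beta)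

lemma tensor_cost_nonneg: "0 \<le> tensor_cost xs"
  by (induction xs) auto

lemma proj_norm_eq: "proj_norm u = Inf {tensor_cost xs | xs. u = tensor_sum xs}"
  by (simp add: proj_norm_def tensor_cost_def tensor_sum_def)

lemma proj_norm_le: "u = tensor_sum xs \<Longrightarrow> proj_norm u \<le> tensor_cost xs"
  unfolding proj_norm_eq by (rule cInf_lower) (auto intro!: bdd_belowI[of _ 0] tensor_cost_nonneg)

lemma proj_norm_greatest: "(\<And>xs. u = tensor_sum xs \<Longrightarrow> r \<le> tensor_cost xs) \<Longrightarrow> r \<le> proj_norm u"
  unfolding proj_norm_eq by (rule cInf_greatest) (use alg_tensor_cases[of u] in blast, blast)

lemma proj_norm_less:
  assumes "proj_norm u < r"
  obtains xs where "u = tensor_sum xs" "tensor_cost xs < r"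
  using proj_norm_greatest[of u r] assms by (meson not_le)

lemma proj_norm_nonneg [simp]: "0 \<le> proj_norm u"
  by (rule proj_norm_greatest) (rule tensor_cost_nonneg)

lemma proj_norm_zero [simp]: "proj_norm 0 = 0"
  using proj_norm_le[of 0 "[]"] by (intro antisym) simp_all

lemma proj_norm_triangle: "proj_norm (u + v) \<le> proj_norm u + proj_norm v"
proof (rule field_le_epsilon)
  fix e :: real
  assume "0 < e"
  obtain xs where xs: "u = tensor_sum xs" "tensor_cost xs < proj_norm u + e / 2"
    by (rule proj_norm_less[of u "proj_norm u + e / 2"]) (use \<open>0 < e\<close> in auto)
  obtain ys where ys: "v = tensor_sum ys" "tensor_cost ys < proj_norm v + e / 2"
    by (rule proj_norm_less[of v "proj_norm v + e / 2"]) (use \<open>0 < e\<close> in auto)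
  show "proj_norm (u + v) \<le> proj_norm u + proj_norm v + e"
    using proj_norm_le[of "u + v" "xs @ ys"] xs ys by simp
qed

lemma scaleC_tensor_sum: "c *\<^sub>C tensor_sum xs = tensor_sum (map (map_prod ((*\<^sub>C) c) id) xs)"
  unfolding abs_alg_tensor_eq[symmetric] by (simp add: scaleC_alg_tensor.abs_eq)

lemma proj_norm_mono:
  assumes "\<And>xs. u = tensor_sum xs \<Longrightarrow> \<exists>ys. v = tensor_sum ys \<and> tensor_cost ys \<le> K * tensor_cost xs"
    and "0 \<le> K"
  shows "proj_norm v \<le> K * proj_norm u"
proof (cases "K = 0")
  case True
  obtain xs where "u = tensor_sum xs"
    by (rule alg_tensor_cases)
  with assms(1) obtain ys where "v = tensor_sum ys" "tensor_cost ys \<le> 0"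
    using True by auto
  then show ?thesis
    using proj_norm_le[of v ys] True by simp
next
  case False
  with \<open>0 \<le> K\<close> have "0 < K" by simp
  have "proj_norm v / K \<le> proj_norm u"
  proof (rule proj_norm_greatest)
    fix xs
    assume "u = tensor_sum xs"
    with assms(1) obtain ys where "v = tensor_sum ys" "tensor_cost ys \<le> K * tensor_cost xs"
      by blast
    then have "proj_norm v \<le> K * tensor_cost xs"
      using proj_norm_le order_trans by blast
    then show "proj_norm v / K \<le> tensor_cost xs"
      using \<open>0 < K\<close> by (simp add: divide_simps mult.commute)
  qed
  then show ?thesis
    using \<open>0 < K\<close> by (simp add: divide_simps mult.commute)
qed

lemma tensor_cost_map_le:
  assumes "\<And>a b. norm (f a) * norm (g b) \<le> K * (norm a * norm b)"
  shows "tensor_cost (map (map_prod f g) xs) \<le> K * tensor_cost xs"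
proof (induction xs)
  case (Cons p xs)
  then show ?case
    using assms[of "fst p" "snd p"] by (simp add: distrib_left)
qed simp

lemma proj_norm_scaleC_le: "proj_norm (c *\<^sub>C u) \<le> cmod c * proj_norm u"
proof (rule proj_norm_mono)
  fix xs
  assume "u = tensor_sum xs"
  then show "\<exists>ys. c *\<^sub>C u = tensor_sum ys \<and> tensor_cost ys \<le> cmod c * tensor_cost xs"
    by (intro exI[of _ "map (map_prod ((*\<^sub>C) c) id) xs"] conjI tensor_cost_map_le)
      (simp_all add: scaleC_tensor_sum norm_scaleC)
qed simp

lemma proj_norm_scaleC: "proj_norm (c *\<^sub>C u) = cmod c * proj_norm u"
proof (rule antisym)
  show "cmod c * proj_norm u \<le> proj_norm (c *\<^sub>C u)"
  proof (cases "c = 0")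
    case False
    then show ?thesis
      using proj_norm_scaleC_le[of "inverse c" "c *\<^sub>C u"]
      by (simp add: scaleC_scaleC norm_divide norm_inverse divide_simps mult.commute)
  qed simp
qed (rule proj_norm_scaleC_le)

lemma proj_norm_minus [simp]: "proj_norm (- u) = proj_norm u"
  using proj_norm_scaleC[of "- 1" u] by (simp add: scaleC_minus_one)

lemma proj_norm_diff_commute: "proj_norm (u - v) = proj_norm (v - u)"
  using proj_norm_minus[of "u - v"] by simp

lemma proj_norm_diff_le: "\<bar>proj_norm u - proj_norm v\<bar> \<le> proj_norm (u - v)"
  using proj_norm_triangle[of "u - v" v] proj_norm_triangle[of "v - u" u]
    proj_norm_diff_commute[of u v] by simp

text \<open>
  The projective tensor product is the completion of the algebraic tensor product with respect
  to \<^const>\<open>proj_norm\<close>: Cauchy sequences modulo null sequences.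
\<close>

definition proj_Cauchy :: "(nat \<Rightarrow> ('a::complex_normed_vector, 'b::complex_normed_vector) alg_tensor) \<Rightarrow> bool"
  where "proj_Cauchy X \<longleftrightarrow> (\<forall>e>0. \<exists>N. \<forall>m\<ge>N. \<forall>n\<ge>N. proj_norm (X m - X n) < e)"

definition proj_eq :: "(nat \<Rightarrow> ('a::complex_normed_vector, 'b::complex_normed_vector) alg_tensor) \<Rightarrow>
    (nat \<Rightarrow> ('a, 'b) alg_tensor) \<Rightarrow> bool"
  where "proj_eq X Y \<longleftrightarrow> proj_Cauchy X \<and> proj_Cauchy Y \<and> (\<lambda>n. proj_norm (X n - Y n)) \<longlonglongrightarrow> 0"

lemma proj_Cauchy_const: "proj_Cauchy (\<lambda>n. u)"
  by (simp add: proj_Cauchy_def)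

lemma proj_eq_refl: "proj_eq X X \<longleftrightarrow> proj_Cauchy X"
  by (simp add: proj_eq_def)

lemma proj_null_squeeze:
  assumes "\<And>n. proj_norm (X n) \<le> f n" "f \<longlonglongrightarrow> 0"
  shows "(\<lambda>n. proj_norm (X n)) \<longlonglongrightarrow> 0"
  by (rule tendsto_sandwich[OF _ _ tendsto_const assms(2)]) (auto simp: assms(1))

lemma proj_eq_sym: "proj_eq X Y \<Longrightarrow> proj_eq Y X"
  by (simp add: proj_eq_def proj_norm_diff_commute)

lemma proj_eq_trans: 
  assumes "proj_eq X Y" "proj_eq Y Z"
  shows "proj_eq X Z"
proof -
  have "(\<lambda>n. proj_norm (X n - Z n)) \<longlonglongrightarrow> 0"
  proof (rule proj_null_squeeze)
    show "proj_norm (X n - Z n) \<le> proj_norm (X n - Y n) + proj_norm (Y n - Z n)" for n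
      using proj_norm_triangle[of "X n - Y n" "Y n - Z n"] by simp
    show "(\<lambda>n. proj_norm (X n - Y n) + proj_norm (Y n - Z n)) \<longlonglongrightarrow> 0"
      using assms tendsto_add_zero unfolding proj_eq_def by blast
  qed
  then show ?thesis
    using assms by (simp add: proj_eq_def)
qed

lemma proj_Cauchy_bound:
  assumes X: "proj_Cauchy X" and "0 \<le> K"
    and T: "\<And>m n. proj_norm (T (X m) - T (X n)) \<le> K * proj_norm (X m - X n)"
  shows "proj_Cauchy (\<lambda>n. T (X n))"
  unfolding proj_Cauchy_def
proof (intro allI impI)
  fix e :: real
  assume "0 < e"
  then have "0 < e / (K + 1)"
    using \<open>0 \<le> K\<close> by simp
  then obtain N where N: "\<And>m n. m \<ge> N \<Longrightarrow> n \<ge> N \<Longrightarrow> proj_norm (X m - X n) < e / (K + 1)"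
    using X unfolding proj_Cauchy_def by meson
  have "proj_norm (T (X m) - T (X n)) < e" if "m \<ge> N" "n \<ge> N" for m n
  proof -
    have "proj_norm (T (X m) - T (X n)) \<le> (K + 1) * proj_norm (X m - X n)"
      using T[of m n] proj_norm_nonneg[of "X m - X n"] by (simp add: distrib_right del: proj_norm_nonneg)
    also have "\<dots> < e"
      using N[OF that] \<open>0 \<le> K\<close> by (simp add: pos_less_divide_eq mult.commute)
    finally show ?thesis .
  qed
  then show "\<exists>N. \<forall>m\<ge>N. \<forall>n\<ge>N. proj_norm (T (X m) - T (X n)) < e"
    by blast
qed

lemma proj_eq_map:
  assumes XY: "proj_eq X Y" and "0 \<le> K"
    and diff: "\<And>u v. T (u - v) = T u - T v"
    and bound: "\<And>u. proj_norm (T u) \<le> K * proj_norm u"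
  shows "proj_eq (\<lambda>n. T (X n)) (\<lambda>n. T (Y n))"
  unfolding proj_eq_def
proof (intro conjI)
  have T: "proj_norm (T u - T v) \<le> K * proj_norm (u - v)" for u v
    using bound[of "u - v"] by (simp add: diff)
  show "proj_Cauchy (\<lambda>n. T (X n))" "proj_Cauchy (\<lambda>n. T (Y n))"
    using XY \<open>0 \<le> K\<close> by (auto simp: proj_eq_def intro: proj_Cauchy_bound T)
  show "(\<lambda>n. proj_norm (T (X n) - T (Y n))) \<longlonglongrightarrow> 0"
    by (rule proj_null_squeeze[OF T]) (use XY in \<open>auto simp: proj_eq_def intro: tendsto_mult_right_zero\<close>)
qed

lemma proj_Cauchy_add:
  assumes "proj_Cauchy X" "proj_Cauchy Y"
  shows "proj_Cauchy (\<lambda>n. X n + Y n)"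
  unfolding proj_Cauchy_def
proof (intro allI impI)
  fix e :: real
  assume "0 < e"
  then have "0 < e / 2" by simp
  obtain M where M: "\<And>m n. m \<ge> M \<Longrightarrow> n \<ge> M \<Longrightarrow> proj_norm (X m - X n) < e / 2"
    using assms(1) \<open>0 < e / 2\<close> unfolding proj_Cauchy_def by meson
  obtain N where N: "\<And>m n. m \<ge> N \<Longrightarrow> n \<ge> N \<Longrightarrow> proj_norm (Y m - Y n) < e / 2"
    using assms(2) \<open>0 < e / 2\<close> unfolding proj_Cauchy_def by meson
  have "proj_norm (X m + Y m - (X n + Y n)) < e" if "m \<ge> max M N" "n \<ge> max M N" for m n
    using proj_norm_triangle[of "X m - X n" "Y m - Y n"] M[of m n] N[of m n] that
    by (simp add: add_diff_add)
  then show "\<exists>N. \<forall>m\<ge>N. \<forall>n\<ge>N. proj_norm (X m + Y m - (X n + Y n)) < e"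
    by blast
qed

lemma proj_eq_add:
  assumes "proj_eq X X'" "proj_eq Y Y'"
  shows "proj_eq (\<lambda>n. X n + Y n) (\<lambda>n. X' n + Y' n)"
proof -
  have "(\<lambda>n. proj_norm (X n + Y n - (X' n + Y' n))) \<longlonglongrightarrow> 0"
  proof (rule proj_null_squeeze)
    show "proj_norm (X n + Y n - (X' n + Y' n)) \<le> proj_norm (X n - X' n) + proj_norm (Y n - Y' n)" for n
      using proj_norm_triangle[of "X n - X' n" "Y n - Y' n"] by (simp add: add_diff_add)
    show "(\<lambda>n. proj_norm (X n - X' n) + proj_norm (Y n - Y' n)) \<longlonglongrightarrow> 0"
      using assms tendsto_add_zero unfolding proj_eq_def by blast
  qed
  then show ?thesis
    using assms by (simp add: proj_eq_def proj_Cauchy_add)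
qed

lemma proj_eq_scaleC: "proj_eq X Y \<Longrightarrow> proj_eq (\<lambda>n. c *\<^sub>C X n) (\<lambda>n. c *\<^sub>C Y n)"
  by (erule proj_eq_map[where K="cmod c"]) (simp_all add: scaleC_diff_right proj_norm_scaleC)

lemma proj_Cauchy_norm_convergent:
  assumes "proj_Cauchy X"
  shows "convergent (\<lambda>n. proj_norm (X n))"
proof -
  have "Cauchy (\<lambda>n. proj_norm (X n))"
    unfolding Cauchy_def dist_real_def
    using assms order_le_less_trans[OF proj_norm_diff_le] unfolding proj_Cauchy_def by fast
  then show ?thesis
    by (rule real_Cauchy_convergent)
qed

lemma proj_norm_LIMSEQ: "proj_Cauchy X \<Longrightarrow> (\<lambda>n. proj_norm (X n)) \<longlonglongrightarrow> lim (\<lambda>n. proj_norm (X n))"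
  using proj_Cauchy_norm_convergent convergent_LIMSEQ_iff by blast

quotient_type (overloaded) ('a, 'b) proj_tensor =
  "nat \<Rightarrow> ('a::complex_normed_vector, 'b::complex_normed_vector) alg_tensor" / partial: proj_eq
proof (rule part_equivpI)
  show "\<exists>X. proj_eq X X"
    by (intro exI[of _ "\<lambda>n. 0"]) (simp add: proj_eq_refl proj_Cauchy_const)
  show "symp proj_eq" "transp proj_eq"
    by (rule sympI, erule proj_eq_sym) (rule transpI, erule proj_eq_trans)
qed

instantiation proj_tensor :: (complex_normed_vector, complex_normed_vector) complex_normed_vector
begin

lift_definition zero_proj_tensor :: "('a, 'b) proj_tensor" is "\<lambda>n. 0"
  by (simp add: proj_eq_refl proj_Cauchy_const)

lift_definition plus_proj_tensor :: "('a, 'b) proj_tensor \<Rightarrow> ('a, 'b) proj_tensor \<Rightarrow> ('a, 'b) proj_tensor"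
  is "\<lambda>X Y n. X n + Y n" by (rule proj_eq_add)

lift_definition scaleC_proj_tensor :: "complex \<Rightarrow> ('a, 'b) proj_tensor \<Rightarrow> ('a, 'b) proj_tensor"
  is "\<lambda>c X n. c *\<^sub>C X n"
  by (rule proj_eq_scaleC)

lift_definition scaleR_proj_tensor :: "real \<Rightarrow> ('a, 'b) proj_tensor \<Rightarrow> ('a, 'b) proj_tensor"
  is "\<lambda>r X n. r *\<^sub>R X n"
  unfolding scaleR_scaleC
  by (rule proj_eq_scaleC)

lift_definition uminus_proj_tensor :: "('a, 'b) proj_tensor \<Rightarrow> ('a, 'b) proj_tensor"
  is "\<lambda>X n. - X n"
  by (erule proj_eq_map[where K=1]) simp_all

lift_definition minus_proj_tensor :: "('a, 'b) proj_tensor \<Rightarrow> ('a, 'b) proj_tensor \<Rightarrow> ('a, 'b) proj_tensor"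
  is "\<lambda>X Y n. X n - Y n"
  subgoal for X X' Y Y'
    using proj_eq_add[of X X' "\<lambda>n. - Y n" "\<lambda>n. - Y' n"] proj_eq_map[of Y Y' 1 uminus] by simp
  done

lift_definition norm_proj_tensor :: "('a, 'b) proj_tensor \<Rightarrow> real"
  is "\<lambda>X. lim (\<lambda>n. proj_norm (X n))"
proof -
  fix X Y :: "nat \<Rightarrow> ('a, 'b) alg_tensor"
  assume XY: "proj_eq X Y"
  have "(\<lambda>n. proj_norm (X n) - proj_norm (Y n)) \<longlonglongrightarrow> 0"
    by (rule Lim_null_comparison[where g="\<lambda>n. proj_norm (X n - Y n)"])
      (use XY in \<open>simp_all add: proj_norm_diff_le proj_eq_def\<close>)
  moreover have "(\<lambda>n. proj_norm (X n) - proj_norm (Y n)) \<longlonglongrightarrow>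
      lim (\<lambda>n. proj_norm (X n)) - lim (\<lambda>n. proj_norm (Y n))"
    using XY by (intro tendsto_diff proj_norm_LIMSEQ) (auto simp: proj_eq_def)
  ultimately show "lim (\<lambda>n. proj_norm (X n)) = lim (\<lambda>n. proj_norm (Y n))"
    using LIMSEQ_unique by force
qed

definition dist_proj_tensor :: "('a, 'b) proj_tensor \<Rightarrow> ('a, 'b) proj_tensor \<Rightarrow> real"
  where "dist_proj_tensor x y = norm (x - y)"

definition uniformity_proj_tensor :: "(('a, 'b) proj_tensor \<times> ('a, 'b) proj_tensor) filter"
  where "uniformity_proj_tensor = (INF e\<in>{0 <..}. principal {(x, y). dist x y < e})"

definition open_proj_tensor :: "('a, 'b) proj_tensor set \<Rightarrow> bool"
  where "open_proj_tensor S = (\<forall>x\<in>S. \<forall>\<^sub>F (x', y) in uniformity. x' = x \<longrightarrow> y \<in> S)"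

definition sgn_proj_tensor :: "('a, 'b) proj_tensor \<Rightarrow> ('a, 'b) proj_tensor"
  where "sgn_proj_tensor x = scaleR (inverse (norm x)) x"

instance
proof
  fix x y z :: "('a, 'b) proj_tensor" and c d :: complex and r s :: real
  show "x + y + z = x + (y + z)"
    by transfer (auto simp: add.assoc intro!: proj_eq_add)
  show "x + y = y + x"
    by transfer (auto simp: add.commute intro!: proj_eq_add)
  show "0 + x = x"
    by transfer simp
  show "- x + x = 0"
    by transfer (simp add: proj_eq_refl proj_Cauchy_const)
  show "x - y = x + - y"
    apply transfer
    subgoal for X Y
      using proj_eq_add[of X X "\<lambda>n. - Y n" "\<lambda>n. - Y n"] proj_eq_map[of Y Y 1 uminus] by simp
    done
  show "c *\<^sub>C (x + y) = c *\<^sub>C x + c *\<^sub>C y"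
    by transfer (auto simp: scaleC_add_right intro!: proj_eq_add proj_eq_scaleC)
  show "(c + d) *\<^sub>C x = c *\<^sub>C x + d *\<^sub>C x"
    by transfer (auto simp: scaleC_add_left intro!: proj_eq_add proj_eq_scaleC)
  show "c *\<^sub>C d *\<^sub>C x = (c * d) *\<^sub>C x"
    by transfer (auto simp: scaleC_scaleC intro!: proj_eq_scaleC)
  have RC: "r *\<^sub>R x = complex_of_real r *\<^sub>C x" for r and x :: "('a, 'b) proj_tensor"
    by transfer (auto simp: scaleR_scaleC intro!: proj_eq_scaleC)
  show "r *\<^sub>R x = complex_of_real r *\<^sub>C x"
    by (rule RC)
  show "r *\<^sub>R (x + y) = r *\<^sub>R x + r *\<^sub>R y"
    by transfer (auto simp: scaleR_scaleC scaleC_add_right intro!: proj_eq_add proj_eq_scaleC)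
  show "(r + s) *\<^sub>R x = r *\<^sub>R x + s *\<^sub>R x"
    by transfer (auto simp: scaleR_scaleC scaleC_add_left intro!: proj_eq_add proj_eq_scaleC)
  show "r *\<^sub>R s *\<^sub>R x = (r * s) *\<^sub>R x"
    by transfer (auto simp: scaleR_scaleC scaleC_scaleC intro!: proj_eq_scaleC)
  show "1 *\<^sub>R x = x"
    by transfer simp
  show "dist x y = norm (x - y)"
    by (rule dist_proj_tensor_def)
  show "sgn x = inverse (norm x) *\<^sub>R x"
    by (rule sgn_proj_tensor_def)
  show "uniformity = (INF e\<in>{0 <..}. principal {(x, y :: ('a, 'b) proj_tensor). dist x y < e})"
    by (rule uniformity_proj_tensor_def)
  show "open U \<longleftrightarrow> (\<forall>x\<in>U. \<forall>\<^sub>F (x', y) in uniformity. x' = x \<longrightarrow> y \<in> U)"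
    for U :: "('a, 'b) proj_tensor set"
    by (rule open_proj_tensor_def)
  show "norm x = 0 \<longleftrightarrow> x = 0"
  proof transfer
    fix X :: "nat \<Rightarrow> ('a, 'b) alg_tensor"
    assume "proj_eq X X"
    then have X: "proj_Cauchy X" by (simp add: proj_eq_refl)
    show "lim (\<lambda>n. proj_norm (X n)) = 0 \<longleftrightarrow> proj_eq X (\<lambda>n. 0)"
      using proj_norm_LIMSEQ[OF X] X limI[of "\<lambda>n. proj_norm (X n)" 0]
      by (auto simp: proj_eq_def proj_Cauchy_const)
  qed
  show "norm (x + y) \<le> norm x + norm y"
  proof transfer
    fix X Y :: "nat \<Rightarrow> ('a, 'b) alg_tensor"
    assume "proj_eq X X" "proj_eq Y Y"
    then have X: "proj_Cauchy X" and Y: "proj_Cauchy Y" by (simp_all add: proj_eq_refl)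
    show "lim (\<lambda>n. proj_norm (X n + Y n)) \<le> lim (\<lambda>n. proj_norm (X n)) + lim (\<lambda>n. proj_norm (Y n))"
      by (rule LIMSEQ_le[OF proj_norm_LIMSEQ[OF proj_Cauchy_add[OF X Y]]
            tendsto_add[OF proj_norm_LIMSEQ[OF X] proj_norm_LIMSEQ[OF Y]]])
        (simp add: proj_norm_triangle)
  qed
  have NC: "norm (c *\<^sub>C x) = cmod c * norm x" for c and x :: "('a, 'b) proj_tensor"
  proof transfer
    fix c and X :: "nat \<Rightarrow> ('a, 'b) alg_tensor"
    assume "proj_eq X X"
    then have X: "proj_Cauchy X" by (simp add: proj_eq_refl)
    show "lim (\<lambda>n. proj_norm (c *\<^sub>C X n)) = cmod c * lim (\<lambda>n. proj_norm (X n))"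
      unfolding proj_norm_scaleC by (rule limI) (intro tendsto_mult_left proj_norm_LIMSEQ X)
  qed
  show "norm (c *\<^sub>C x) = cmod c * norm x"
    by (rule NC)
  show "norm (r *\<^sub>R x) = \<bar>r\<bar> * norm x"
    by (simp add: RC NC)
qed

end

lift_definition proj_embed :: "('a::complex_normed_vector, 'b::complex_normed_vector) alg_tensor \<Rightarrow> ('a, 'b) proj_tensor"
  is "\<lambda>u n. u" by (simp add: proj_eq_refl proj_Cauchy_const)

definition tens :: "'a::complex_normed_vector \<Rightarrow> 'b::complex_normed_vector \<Rightarrow> ('a, 'b) proj_tensor"
  where "tens a b = proj_embed (alg_tens a b)"

lemma norm_proj_embed: "norm (proj_embed u) = proj_norm u"
  by transfer (simp add: limI)

lemma proj_embed_add: "proj_embed (u + v) = proj_embed u + proj_embed v"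
  by transfer (simp add: proj_eq_refl proj_Cauchy_const)

lemma proj_embed_diff: "proj_embed (u - v) = proj_embed u - proj_embed v"
  by transfer (simp add: proj_eq_refl proj_Cauchy_const)

lemma proj_embed_zero: "proj_embed 0 = 0"
  by transfer (simp add: proj_eq_refl proj_Cauchy_const)

lemma proj_embed_scaleC: "proj_embed (c *\<^sub>C u) = c *\<^sub>C proj_embed u"
  by transfer (simp add: proj_eq_refl proj_Cauchy_const)

lemma norm_tens_le: "norm (tens a b) \<le> norm a * norm b"
  using proj_norm_le[of "alg_tens a b" "[(a, b)]"] by (simp add: tens_def norm_proj_embed)

lemma proj_embed_tensor_sum: "proj_embed (tensor_sum xs) = (\<Sum>(a, b)\<leftarrow>xs. tens a b)"
  by (induction xs) (auto simp: proj_embed_add proj_embed_zero tens_def)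

lemma proj_tensor_limit:
  assumes X: "proj_Cauchy X"
  shows "(\<lambda>n. proj_embed (X n)) \<longlonglongrightarrow> abs_proj_tensor X"
proof (rule metric_LIMSEQ_I)
  fix e :: real
  assume "0 < e"
  then have "0 < e / 2" by simp
  then obtain N where N: "\<And>m n. m \<ge> N \<Longrightarrow> n \<ge> N \<Longrightarrow> proj_norm (X m - X n) < e / 2"
    using X unfolding proj_Cauchy_def by meson
  have "dist (proj_embed (X n)) (abs_proj_tensor X) < e" if "n \<ge> N" for n
  proof -
    have *: "proj_eq X X" "proj_eq (\<lambda>_. X n) (\<lambda>_. X n)"
      using X by (simp_all add: proj_eq_refl proj_Cauchy_const)
    then have C: "proj_eq (\<lambda>m. X n - X m) (\<lambda>m. X n - X m)"
      using proj_eq_add[OF *(2) proj_eq_map[OF *(1), of 1 uminus]] by simp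
    have "dist (proj_embed (X n)) (abs_proj_tensor X) = lim (\<lambda>m. proj_norm (X n - X m))"
      using * C by (simp add: dist_norm proj_embed.abs_eq minus_proj_tensor.abs_eq norm_proj_tensor.abs_eq)
    also have "\<dots> \<le> e / 2"
      by (rule LIMSEQ_le_const2[OF proj_norm_LIMSEQ])
        (use C N that in \<open>auto simp: proj_eq_refl intro!: exI[of _ N] less_imp_le\<close>)
    also have "\<dots> < e" using \<open>0 < e\<close> by simp
    finally show ?thesis .
  qed
  then show "\<exists>N. \<forall>n\<ge>N. dist (proj_embed (X n)) (abs_proj_tensor X) < e"
    by blast
qed

lemma proj_tensor_cases:
  obtains X where "proj_Cauchy X" "x = abs_proj_tensor X"
  by (metis Quotient_proj_tensor Quotient_abs_rep Quotient_rep_reflp proj_eq_refl)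

lemma proj_embed_dense:
  assumes "0 < e"
  obtains u where "dist (proj_embed u) x < e"
proof -
  obtain X where "proj_Cauchy X" "x = abs_proj_tensor X"
    by (rule proj_tensor_cases)
  then show ?thesis
    using metric_LIMSEQ_D[OF proj_tensor_limit assms] that by blast
qed

instance proj_tensor :: (complex_normed_vector, complex_normed_vector) complex_banach
proof
  fix Z :: "nat \<Rightarrow> ('a, 'b) proj_tensor"
  assume Z: "Cauchy Z"
  have "\<exists>u. dist (proj_embed u) (Z k) < 1 / Suc k" for k
    by (rule proj_embed_dense[of "1 / Suc k" "Z k"]) auto
  then obtain u where u: "\<And>k. dist (proj_embed (u k)) (Z k) < 1 / Suc k"
    by metis
  have diff: "(\<lambda>k. proj_embed (u k) - Z k) \<longlonglongrightarrow> 0"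
    by (rule Lim_null_comparison[OF _ LIMSEQ_inverse_real_of_nat])
      (use u in \<open>auto simp: dist_norm inverse_eq_divide intro!: always_eventually less_imp_le\<close>)
  have "Cauchy (\<lambda>k. (proj_embed (u k) - Z k) + Z k)"
    unfolding Cauchy_def
  proof (intro allI impI)
    fix e :: real
    assume "0 < e"
    then have "0 < e / 2" by simp
    obtain M where M: "\<And>m n. m \<ge> M \<Longrightarrow> n \<ge> M \<Longrightarrow> dist (proj_embed (u m) - Z m) (proj_embed (u n) - Z n) < e / 2"
      using LIMSEQ_imp_Cauchy[OF diff] \<open>0 < e / 2\<close> unfolding Cauchy_def by meson
    obtain N where N: "\<And>m n. m \<ge> N \<Longrightarrow> n \<ge> N \<Longrightarrow> dist (Z m) (Z n) < e / 2"
      using Z \<open>0 < e / 2\<close> unfolding Cauchy_def by meson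
    have "dist (proj_embed (u m) - Z m + Z m) (proj_embed (u n) - Z n + Z n) < e"
      if "m \<ge> max M N" "n \<ge> max M N" for m n
      using dist_triangle_add[of "proj_embed (u m) - Z m" "Z m" "proj_embed (u n) - Z n" "Z n"]
        M[of m n] N[of m n] that by simp
    then show "\<exists>N. \<forall>m\<ge>N. \<forall>n\<ge>N. dist (proj_embed (u m) - Z m + Z m) (proj_embed (u n) - Z n + Z n) < e"
      by blast
  qed
  then have "Cauchy (\<lambda>k. proj_embed (u k))"
    by simp
  then have "proj_Cauchy u"
    by (simp add: Cauchy_def proj_Cauchy_def dist_norm proj_embed_diff[symmetric] norm_proj_embed)
  from tendsto_diff[OF proj_tensor_limit[OF this] diff] show "convergent Z"
    by (auto intro: convergentI)
qed


section \<open>The bimodule \<open>A \<otimes>\<^sub>p A\<close> and the product map\<close>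

lemma proj_norm_alg_left: "proj_norm (alg_left a u) \<le> norm a * proj_norm u"
proof (rule proj_norm_mono)
  fix xs
  assume "u = tensor_sum xs"
  moreover have "tensor_cost (map (map_prod (\<lambda>b. a * b) id) xs) \<le> norm a * tensor_cost xs"
    by (rule tensor_cost_map_le) (simp add: mult.assoc[symmetric] mult_right_mono norm_mult_ineq)
  ultimately show "\<exists>ys. alg_left a u = tensor_sum ys \<and> tensor_cost ys \<le> norm a * tensor_cost xs"
    by (metis abs_alg_tensor_eq alg_left.abs_eq)
qed simp

lemma proj_norm_alg_right: "proj_norm (alg_right a u) \<le> norm a * proj_norm u"
proof (rule proj_norm_mono)
  fix xs
  assume "u = tensor_sum xs"
  moreover have "tensor_cost (map (map_prod id (\<lambda>c. c * a)) xs) \<le> norm a * tensor_cost xs"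
  proof (rule tensor_cost_map_le)
    fix b c :: 'a
    have "norm b * norm (c * a) \<le> norm b * (norm c * norm a)"
      by (intro mult_left_mono norm_mult_ineq) simp
    then show "norm (id b) * norm (c * a) \<le> norm a * (norm b * norm c)"
      by (simp add: ac_simps)
  qed
  ultimately show "\<exists>ys. alg_right a u = tensor_sum ys \<and> tensor_cost ys \<le> norm a * tensor_cost xs"
    by (metis abs_alg_tensor_eq alg_right.abs_eq)
qed simp

lemma norm_alg_mult: "norm (alg_mult u) \<le> proj_norm u"
proof (rule proj_norm_greatest)
  fix xs
  assume u: "u = tensor_sum xs"
  have "norm (\<Sum>(a, b)\<leftarrow>xs. a * b) \<le> tensor_cost xs"
  proof (induction xs)
    case (Cons p xs)
    then show ?case
      using norm_triangle_ineq[of "fst p * snd p" "\<Sum>(a, b)\<leftarrow>xs. a * b"]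
        norm_mult_ineq[of "fst p" "snd p"]
      by (simp add: case_prod_beta')
  qed simp
  then show "norm (alg_mult u) \<le> tensor_cost xs"
    by (simp add: u alg_mult_tensor_sum)
qed

lemma proj_eq_alg_left: "proj_eq X Y \<Longrightarrow> proj_eq (\<lambda>n. alg_left a (X n)) (\<lambda>n. alg_left a (Y n))"
  by (erule proj_eq_map[where K="norm a"]) (simp_all add: alg_left_diff proj_norm_alg_left)

lift_definition tensor_left :: "'a \<Rightarrow> ('a::complex_banach_algebra, 'a) proj_tensor \<Rightarrow> ('a, 'a) proj_tensor"
  is "\<lambda>a X n. alg_left a (X n)"
  by (rule proj_eq_alg_left)

lemma proj_eq_alg_right: "proj_eq X Y \<Longrightarrow> proj_eq (\<lambda>n. alg_right a (X n)) (\<lambda>n. alg_right a (Y n))"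
  by (erule proj_eq_map[where K="norm a"]) (simp_all add: alg_right_diff proj_norm_alg_right)

lift_definition tensor_right :: "'a \<Rightarrow> ('a::complex_banach_algebra, 'a) proj_tensor \<Rightarrow> ('a, 'a) proj_tensor"
  is "\<lambda>a X n. alg_right a (X n)"
  by (rule proj_eq_alg_right)

lemma alg_mult_LIMSEQ:
  assumes "proj_Cauchy X"
  shows "(\<lambda>n. alg_mult (X n)) \<longlonglongrightarrow> lim (\<lambda>n. alg_mult (X n))"
proof -
  have "Cauchy (\<lambda>n. alg_mult (X n))"
    unfolding Cauchy_def dist_norm alg_mult_diff[symmetric]
    using assms norm_alg_mult order_le_less_trans unfolding proj_Cauchy_def by meson
  then show ?thesis
    using Cauchy_convergent convergent_LIMSEQ_iff by blast
qed

lift_definition tensor_mult :: "('a::complex_banach_algebra, 'a) proj_tensor \<Rightarrow> 'a"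
  is "\<lambda>X. lim (\<lambda>n. alg_mult (X n))"
proof -
  fix X Y :: "nat \<Rightarrow> ('a, 'a) alg_tensor"
  assume XY: "proj_eq X Y"
  have "(\<lambda>n. alg_mult (X n) - alg_mult (Y n)) \<longlonglongrightarrow> 0"
    by (rule Lim_null_comparison[where g="\<lambda>n. proj_norm (X n - Y n)"])
      (use XY in \<open>simp_all add: norm_alg_mult proj_eq_def alg_mult_diff[symmetric]\<close>)
  moreover have "(\<lambda>n. alg_mult (X n) - alg_mult (Y n)) \<longlonglongrightarrow>
      lim (\<lambda>n. alg_mult (X n)) - lim (\<lambda>n. alg_mult (Y n))"
    using XY by (intro tendsto_diff alg_mult_LIMSEQ) (auto simp: proj_eq_def)
  ultimately show "lim (\<lambda>n. alg_mult (X n)) = lim (\<lambda>n. alg_mult (Y n))"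
    using LIMSEQ_unique by force
qed

lemma tensor_left_embed: "tensor_left a (proj_embed u) = proj_embed (alg_left a u)"
  by transfer (simp add: proj_eq_refl proj_Cauchy_const)

lemma tensor_right_embed: "tensor_right a (proj_embed u) = proj_embed (alg_right a u)"
  by transfer (simp add: proj_eq_refl proj_Cauchy_const)

lemma tensor_mult_embed: "tensor_mult (proj_embed u) = alg_mult u"
  by transfer (simp add: limI)

lemma tensor_left_tens: "tensor_left a (tens b c) = tens (a * b) c"
  by (simp add: tens_def tensor_left_embed alg_left_alg_tens)

lemma tensor_right_tens: "tensor_right a (tens b c) = tens b (c * a)"
  by (simp add: tens_def tensor_right_embed alg_right_alg_tens)

lemma tensor_mult_tens: "tensor_mult (tens a b) = a * b"
  by (simp add: tens_def tensor_mult_embed alg_mult_alg_tens)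

lemma bounded_clinear_tensor_left: "bounded_clinear (tensor_left a)"
proof -
  have 1: "tensor_left a (x + y) = tensor_left a x + tensor_left a y" for x y
    by transfer (simp add: alg_left_add proj_eq_add proj_eq_alg_left)
  have 2: "tensor_left a (c *\<^sub>C x) = c *\<^sub>C tensor_left a x" for c x
    by transfer (simp add: alg_left_scaleC proj_eq_scaleC proj_eq_alg_left)
  have 3: "norm (tensor_left a x) \<le> norm x * norm a" for x
  proof transfer
    fix a :: 'a and X :: "nat \<Rightarrow> ('a, 'a) alg_tensor"
    assume "proj_eq X X"
    moreover from this have "proj_eq (\<lambda>n. alg_left a (X n)) (\<lambda>n. alg_left a (X n))"
      by (rule proj_eq_alg_left)
    ultimately show "lim (\<lambda>n. proj_norm (alg_left a (X n))) \<le> lim (\<lambda>n. proj_norm (X n)) * norm a"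
      by (intro LIMSEQ_le[OF proj_norm_LIMSEQ tendsto_mult_right[OF proj_norm_LIMSEQ]])
        (auto simp: proj_eq_refl mult.commute proj_norm_alg_left)
  qed
  show ?thesis
    unfolding bounded_clinear_def
    by (auto simp: 1 2 3 scaleR_scaleC intro!: bounded_linear_intro[where K="norm a"])
qed

lemma bounded_clinear_tensor_right: "bounded_clinear (tensor_right a)"
proof -
  have 1: "tensor_right a (x + y) = tensor_right a x + tensor_right a y" for x y
    by transfer (simp add: alg_right_add proj_eq_add proj_eq_alg_right)
  have 2: "tensor_right a (c *\<^sub>C x) = c *\<^sub>C tensor_right a x" for c x
    by transfer (simp add: alg_right_scaleC proj_eq_scaleC proj_eq_alg_right)
  have 3: "norm (tensor_right a x) \<le> norm x * norm a" for x
  proof transfer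
    fix a :: 'a and X :: "nat \<Rightarrow> ('a, 'a) alg_tensor"
    assume "proj_eq X X"
    moreover from this have "proj_eq (\<lambda>n. alg_right a (X n)) (\<lambda>n. alg_right a (X n))"
      by (rule proj_eq_alg_right)
    ultimately show "lim (\<lambda>n. proj_norm (alg_right a (X n))) \<le> lim (\<lambda>n. proj_norm (X n)) * norm a"
      by (intro LIMSEQ_le[OF proj_norm_LIMSEQ tendsto_mult_right[OF proj_norm_LIMSEQ]])
        (auto simp: proj_eq_refl mult.commute proj_norm_alg_right)
  qed
  show ?thesis
    unfolding bounded_clinear_def
    by (auto simp: 1 2 3 scaleR_scaleC intro!: bounded_linear_intro[where K="norm a"])
qed

lemma bounded_clinear_tensor_mult:
  "bounded_clinear (tensor_mult :: ('a::complex_banach_algebra, 'a) proj_tensor \<Rightarrow> 'a)"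
proof -
  have 1: "tensor_mult (x + y) = tensor_mult x + tensor_mult y" for x y :: "('a, 'a) proj_tensor"
    by transfer (auto simp: alg_mult_add proj_eq_refl intro!: limI tendsto_add alg_mult_LIMSEQ)
  have sc: "((*\<^sub>C) c \<circ> Z) \<longlonglongrightarrow> c *\<^sub>C l" if "Z \<longlonglongrightarrow> l" for c and Z :: "nat \<Rightarrow> 'a" and l
  proof -
    have "bounded_linear ((*\<^sub>C) c :: 'a \<Rightarrow> 'a)"
      by (rule bounded_linear_intro[where K="cmod c"])
        (simp_all add: scaleC_add_right scaleR_scaleC scaleC_scaleC norm_scaleC mult.commute)
    from bounded_linear.tendsto[OF this that] show ?thesis
      by (simp add: o_def)
  qed
  have 2: "tensor_mult (c *\<^sub>C x) = c *\<^sub>C tensor_mult x" for c and x :: "('a, 'a) proj_tensor"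
    by transfer (auto simp: alg_mult_scaleC proj_eq_refl intro!: limI sc[unfolded o_def] alg_mult_LIMSEQ)
  have 3: "norm (tensor_mult x) \<le> norm x * 1" for x :: "('a, 'a) proj_tensor"
  proof transfer
    fix X :: "nat \<Rightarrow> ('a, 'a) alg_tensor"
    assume "proj_eq X X"
    then have X: "proj_Cauchy X" by (simp add: proj_eq_refl)
    show "norm (lim (\<lambda>n. alg_mult (X n))) \<le> lim (\<lambda>n. proj_norm (X n)) * 1"
      using LIMSEQ_le[OF tendsto_norm[OF alg_mult_LIMSEQ[OF X]] proj_norm_LIMSEQ[OF X]]
      by (simp add: norm_alg_mult)
  qed
  show ?thesis
    unfolding bounded_clinear_def
    by (intro conjI allI bounded_linear_intro[where K=1] 1 2 3) (simp add: scaleR_scaleC 2)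
qed


section \<open>Nets and amenability\<close>

definition directed_set :: "'i set \<Rightarrow> ('i \<Rightarrow> 'i \<Rightarrow> bool) \<Rightarrow> bool"
  where "directed_set I le \<longleftrightarrow> I \<noteq> {} \<and> reflp_on I le \<and> transp_on I le \<and>
    (\<forall>i\<in>I. \<forall>j\<in>I. \<exists>k\<in>I. le i k \<and> le j k)"

text \<open>The filter of tails of \<open>I\<close>, so that \<open>(m \<longlongrightarrow> x) (tails I le)\<close> is convergence of the net \<open>m\<close>.\<close>

definition tails :: "'i set \<Rightarrow> ('i \<Rightarrow> 'i \<Rightarrow> bool) \<Rightarrow> 'i filter"
  where "tails I le = (INF i\<in>I. principal {j \<in> I. le i j})"

lemma eventually_tails:
  assumes "directed_set I le"
  shows "eventually P (tails I le) \<longleftrightarrow> (\<exists>i\<in>I. \<forall>j\<in>I. le i j \<longrightarrow> P j)"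
proof -
  have "\<exists>k\<in>I. principal {l \<in> I. le k l} \<le> inf (principal {l \<in> I. le i l}) (principal {l \<in> I. le j l})"
    if ij: "i \<in> I" "j \<in> I" for i j
  proof -
    obtain k where k: "k \<in> I" "le i k" "le j k"
      using assms ij unfolding directed_set_def by blast
    have "le i l" "le j l" if "l \<in> I" "le k l" for l
      using assms ij k that unfolding directed_set_def by (meson transp_onD)+
    with k show ?thesis by (intro bexI[of _ k]) auto
  qed
  then show ?thesis
    using assms unfolding tails_def
    by (subst eventually_INF_base) (auto simp: directed_set_def eventually_principal)
qed

text \<open>
  A definition cannot quantify over all index types, so the index type \<open>'i\<close> of the net is a
  parameter of the next two notions. For pseudo-amenability, the type \<open>'a set \<times> nat\<close> (finite
  subsets of the algebra paired with an accuracy) is always large enough; see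
  \<open>pseudo_amenable_index\<close> below.
\<close>

definition strong_pseudo_amenable :: "'i itself \<Rightarrow> 'a::complex_banach_algebra itself \<Rightarrow> bool"
  where "strong_pseudo_amenable _ _ \<longleftrightarrow>
    (\<exists>(I :: 'i set) le (m :: 'i \<Rightarrow> ('a, 'a) proj_tensor dual dual).
      directed_set I le \<and>
      (\<forall>a.
        ((\<lambda>i. bidual_left tensor_left a (m i) - bidual_right tensor_right a (m i)) \<longlongrightarrow> 0) (tails I le) \<and>
        (\<forall>i\<in>I. bidual_left (\<lambda>a x. a * x) a (adjoint (adjoint tensor_mult) (m i)) =
                bidual_right (\<lambda>a x. x * a) a (adjoint (adjoint tensor_mult) (m i))) \<and>
        ((\<lambda>i. bidual_right (\<lambda>a x. x * a) a (adjoint (adjoint tensor_mult) (m i)))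
          \<longlongrightarrow> canonical_embedding a) (tails I le)))"

definition pseudo_amenable :: "'i itself \<Rightarrow> 'a::complex_banach_algebra itself \<Rightarrow> bool"
  where "pseudo_amenable _ _ \<longleftrightarrow>
    (\<exists>(I :: 'i set) le (m :: 'i \<Rightarrow> ('a, 'a) proj_tensor).
      directed_set I le \<and>
      (\<forall>a.
        ((\<lambda>i. tensor_left a (m i) - tensor_right a (m i)) \<longlongrightarrow> 0) (tails I le) \<and>
        ((\<lambda>i. tensor_mult (m i) * a) \<longlongrightarrow> a) (tails I le)))"

definition finset_le :: "'a set \<times> nat \<Rightarrow> 'a set \<times> nat \<Rightarrow> bool"
  where "finset_le p q \<longleftrightarrow> fst p \<subseteq> fst q \<and> snd p \<le> snd q"

lemma directed_finset_le: "directed_set {p. finite (fst p)} finset_le"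
  unfolding directed_set_def
proof (intro conjI ballI)
  fix p q :: "'a set \<times> nat"
  assume "p \<in> {p. finite (fst p)}" "q \<in> {p. finite (fst p)}"
  then show "\<exists>k\<in>{p. finite (fst p)}. finset_le p k \<and> finset_le q k"
    by (intro bexI[of _ "(fst p \<union> fst q, max (snd p) (snd q))"]) (auto simp: finset_le_def)
qed (auto simp: finset_le_def reflp_on_def transp_on_def)

lemma tails_finset_tendstoI:
  fixes f :: "'a set \<times> nat \<Rightarrow> 'x::real_normed_vector"
  assumes "\<And>F n. finite F \<Longrightarrow> a \<in> F \<Longrightarrow> dist (f (F, n)) l < 1 / Suc n"
  shows "(f \<longlongrightarrow> l) (tails {p. finite (fst p)} finset_le)"
proof (rule tendstoI)
  fix e :: real
  assume "0 < e"
  then obtain N where N: "1 / Suc N < e"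
    by (rule nat_approx_posE)
  have "dist (f (F, n)) l < e" if "finite F" "a \<in> F" "N \<le> n" for F n
  proof -
    have "1 / Suc n \<le> 1 / Suc N"
      using that by (simp add: frac_le)
    with assms[OF that(1,2), of n] N show ?thesis by linarith
  qed
  then show "\<forall>\<^sub>F p in tails {p. finite (fst p)} finset_le. dist (f p) l < e"
    unfolding eventually_tails[OF directed_finset_le]
    by (intro bexI[of _ "({a}, N)"]) (auto simp: finset_le_def)
qed

lemma tails_neq_bot: "directed_set I le \<Longrightarrow> tails I le \<noteq> bot"
  unfolding trivial_limit_def eventually_tails
  by (auto simp: directed_set_def reflp_on_def)

lemma pseudo_amenable_index:
  assumes "pseudo_amenable TYPE('i) TYPE('a::complex_banach_algebra)"
  shows "pseudo_amenable TYPE('a set \<times> nat) TYPE('a)"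
proof -
  obtain I :: "'i set" and le and m :: "'i \<Rightarrow> ('a, 'a) proj_tensor" where
    I: "directed_set I le" and
    m: "\<And>a. ((\<lambda>i. tensor_left a (m i) - tensor_right a (m i)) \<longlongrightarrow> 0) (tails I le)"
       "\<And>a. ((\<lambda>i. tensor_mult (m i) * a) \<longlongrightarrow> a) (tails I le)"
    using assms unfolding pseudo_amenable_def by blast
  define good where "good F n t \<longleftrightarrow> (\<forall>a\<in>F. dist (tensor_left a t - tensor_right a t) 0 < 1 / real (Suc n) \<and>
      dist (tensor_mult t * a) a < 1 / real (Suc n))" for F :: "'a set" and n t
  define t where "t F n = (SOME t. good F n t)" for F n
  have t: "good F n (t F n)" if "finite F" for F n
  proof -
    have "\<forall>\<^sub>F i in tails I le. good F n (m i)"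
      unfolding good_def
      using that by (intro eventually_ball_finite ballI eventually_conj tendstoD m) auto
    from eventually_happens'[OF tails_neq_bot[OF I] this] show ?thesis
      unfolding t_def by (blast intro: someI)
  qed
  show ?thesis
    unfolding pseudo_amenable_def
  proof (intro exI conjI allI)
    fix a :: 'a
    show "((\<lambda>p. tensor_left a (t (fst p) (snd p)) - tensor_right a (t (fst p) (snd p))) \<longlongrightarrow> 0)
        (tails {p. finite (fst p)} finset_le)"
      and "((\<lambda>p. tensor_mult (t (fst p) (snd p)) * a) \<longlongrightarrow> a) (tails {p. finite (fst p)} finset_le)"
      by (rule tails_finset_tendstoI[where a=a], use t in \<open>auto simp only: good_def fst_conv snd_conv\<close>)+
  qed (rule directed_finset_le)
qed

end

theory Submission
  imports Defs
begin

text \<open>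
  Fix a finite set \<open>F\<close>. The elements \<open>(a \<cdot> t - t \<cdot> a, \<pi>(t) a)\<^sub>a\<^sub>\<in>\<^sub>F\<close> form a subspace of a finite product of
  Banach spaces. A functional that vanishes on this subspace also vanishes on the corresponding
  elements of the bidual built from \<open>m\<^sub>\<alpha>\<close>, hence on their norm limit \<open>(0, a)\<^sub>a\<^sub>\<in>\<^sub>F\<close>. By Hahn-Banach,
  \<open>(0, a)\<^sub>a\<^sub>\<in>\<^sub>F\<close> lies in the norm closure of the subspace, so some \<open>t\<close> is as good as desired for \<open>F\<close>.
\<close>

section \<open>Sublinear functionals and Hahn-Banach domination\<close>

definition sublinear :: "('v::real_vector \<Rightarrow> real) \<Rightarrow> bool"
  where "sublinear p \<longleftrightarrow> (\<forall>x y. p (x + y) \<le> p x + p y) \<and> (\<forall>r x. 0 \<le> r \<longrightarrow> p (r *\<^sub>R x) = r * p x)"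

lemma sublinear_add: "sublinear p \<Longrightarrow> p (x + y) \<le> p x + p y"
  and sublinear_scaleR: "sublinear p \<Longrightarrow> 0 \<le> r \<Longrightarrow> p (r *\<^sub>R x) = r * p x"
  by (auto simp: sublinear_def)

lemma sublinear_zero: "sublinear p \<Longrightarrow> p 0 = 0"
  using sublinear_scaleR[of p 0 0] by simp

lemma sublinear_minus: "sublinear p \<Longrightarrow> - p (- x) \<le> p x"
  using sublinear_add[of p x "- x"] sublinear_zero[of p] by simp

text \<open>The reverse inequality comes from applying \<open>scale\<close> to
  \<open>inverse r\<close> and \<open>r *\<^sub>R x\<close>. The factors 2 and 1/2 force
  \<open>p 0 = 0\<close>.\<close>

lemma sublinearI:
  assumes add: "\<And>x y. p (x + y) \<le> p x + p y"
    and scale: "\<And>r x. 0 < r \<Longrightarrow> p (r *\<^sub>R x) \<le> r * p x"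
  shows "sublinear p"
proof -
  have zero: "p 0 = 0"
    using scale[of 2 0] scale[of "1/2" 0] by simp
  have "p (r *\<^sub>R x) = r * p x" if "0 \<le> r" for r x
  proof (cases "r = 0")
    case False
    with that have r: "0 < r" by simp
    have "p x \<le> inverse r * p (r *\<^sub>R x)"
      using scale[of "inverse r" "r *\<^sub>R x"] r by simp
    then have "r * p x \<le> p (r *\<^sub>R x)"
      using r by (simp add: field_simps)
    then show ?thesis
      using scale[OF r, of x] by linarith
  qed (simp add: zero)
  then show ?thesis
    using add by (simp add: sublinear_def)
qed

lemma sublinear_norm: "sublinear norm"
  by (auto simp: sublinear_def norm_triangle_ineq)

text \<open>Lowers \<open>p\<close> just enough that every linear \<open>f\<close> below
  \<open>q\<close> satisfies both \<open>f \<le> p\<close> and \<open>- f (T x) \<le> c x\<close> on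
  the cone \<open>U\<close>. A ray as \<open>U\<close> serves to show that minimal functionals are
  odd; the whole space serves to split off one map from a sum.\<close>

lemma sublinear_inf_convolution:
  fixes p :: "'v::real_vector \<Rightarrow> real" and T :: "'u::real_vector \<Rightarrow> 'v"
  assumes p: "sublinear p" and T: "linear T"
    and U: "0 \<in> U" "\<And>x y. x \<in> U \<Longrightarrow> y \<in> U \<Longrightarrow> x + y \<in> U" "\<And>r x. 0 < r \<Longrightarrow> x \<in> U \<Longrightarrow> r *\<^sub>R x \<in> U"
    and c: "\<And>x y. x \<in> U \<Longrightarrow> y \<in> U \<Longrightarrow> c (x + y) \<le> c x + c y"
      "\<And>r x. 0 < r \<Longrightarrow> x \<in> U \<Longrightarrow> c (r *\<^sub>R x) = r * c x" "c 0 = 0"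
    and pos: "\<And>x. x \<in> U \<Longrightarrow> 0 \<le> p (T x) + c x"
  obtains q where "sublinear q" "\<And>y. q y \<le> p y" "\<And>x. x \<in> U \<Longrightarrow> q (- T x) \<le> c x"
proof
  define q where "q y = (INF x\<in>U. p (y + T x) + c x)" for y
  have bdd: "bdd_below ((\<lambda>x. p (y + T x) + c x) ` U)" for y
  proof (rule bdd_belowI2)
    fix x assume "x \<in> U"
    \<comment> \<open>Subadditivity gives \<open>p (T x) \<le> p (y + T x) + p (- y)\<close>, so
      \<open>pos\<close> bounds the values from below uniformly in \<open>x\<close>.\<close>
    then show "- p (- y) \<le> p (y + T x) + c x"
      using sublinear_add[OF p, of "y + T x" "- y"] pos[of x] by simp
  qed
  have lower: "q y \<le> p (y + T x) + c x" if "x \<in> U" for x y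
    unfolding q_def by (rule cINF_lower[OF bdd that])
  have greatest: "b \<le> q y" if "\<And>x. x \<in> U \<Longrightarrow> b \<le> p (y + T x) + c x" for b y
    unfolding q_def using U(1) that by (intro cINF_greatest) auto
  show "sublinear q"
  proof (rule sublinearI)
    fix y z
    have "q (y + z) - (p (z + T x') + c x') \<le> q y" if x': "x' \<in> U" for x'
    proof (rule greatest)
      fix x assume x: "x \<in> U"
      show "q (y + z) - (p (z + T x') + c x') \<le> p (y + T x) + c x"
        using lower[of "x + x'" "y + z"] U(2)[OF x x'] c(1)[OF x x']
          sublinear_add[OF p, of "y + T x" "z + T x'"] by (simp add: linear_add[OF T] add_ac)
    qed
    then have "q (y + z) - q y \<le> q z"
      by (intro greatest) (smt (verit))
    then show "q (y + z) \<le> q y + q z" by simp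
  next
    fix r :: real and y assume r: "0 < r"
    have "q (r *\<^sub>R y) / r \<le> q y"
    proof (rule greatest)
      fix x assume x: "x \<in> U"
      have "q (r *\<^sub>R y) \<le> p (r *\<^sub>R (y + T x)) + r * c x"
        using lower[of "r *\<^sub>R x" "r *\<^sub>R y"] U(3)[OF r x] c(2)[OF r x]
        by (simp add: linear_scale[OF T] scaleR_add_right)
      then show "q (r *\<^sub>R y) / r \<le> p (y + T x) + c x"
        using r sublinear_scaleR[OF p, of r "y + T x"] by (simp add: field_simps)
    qed
    then show "q (r *\<^sub>R y) \<le> r * q y"
      using r by (simp add: field_simps)
  qed
  show "q y \<le> p y" for y
    using lower[OF U(1), of y] by (simp add: linear_0[OF T] c(3))
  show "q (- T x) \<le> c x" if "x \<in> U" for x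
    using lower[OF that, of "- T x"] by (simp add: sublinear_zero[OF p])
qed

text \<open>The infimum of \<open>p (y + t v) - t p v\<close> over \<open>t \<ge> 0\<close> is sublinear and below \<open>p\<close>, hence equal to \<open>p\<close>.
  Its value at \<open>- v\<close> is at most \<open>- p v\<close>, so \<open>p\<close> is odd.\<close>

lemma minimal_sublinear_imp_linear:
  assumes p: "sublinear p" and min: "\<And>q. sublinear q \<Longrightarrow> (\<And>x. q x \<le> p x) \<Longrightarrow> q = p"
  shows "linear p"
proof -
  have odd: "p (- v) = - p v" for v
  proof -
    have "linear (\<lambda>t::real. t *\<^sub>R v)"
      by (rule linearI) (simp_all add: scaleR_add_left)
    then obtain q where q: "sublinear q" "\<And>x. q x \<le> p x" "\<And>t. t \<in> {0..} \<Longrightarrow> q (- (t *\<^sub>R v)) \<le> - (t * p v)"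
      by (rule sublinear_inf_convolution[OF p, where U="{0..}" and c="\<lambda>t. - (t * p v)"])
        (auto simp: distrib_right sublinear_scaleR[OF p])
    show ?thesis
      using q(3)[of 1] min[OF q(1,2)] sublinear_minus[OF p, of v] by simp
  qed
  \<comment> \<open>By oddness, subadditivity at \<open>- x\<close> and \<open>- y\<close> is
    superadditivity at \<open>x\<close> and \<open>y\<close>.\<close>
  have "p (x + y) = p x + p y" for x y
    using sublinear_add[OF p, of x y] sublinear_add[OF p, of "- x" "- y"] odd[of x] odd[of y] odd[of "x + y"]
    by simp
  moreover have "p (r *\<^sub>R x) = r *\<^sub>R p x" for r x
    using sublinear_scaleR[OF p, of r x] sublinear_scaleR[OF p, of "- r" x] odd[of "r *\<^sub>R x"]
    by (cases "0 \<le> r") auto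
  ultimately show ?thesis by (rule linearI)
qed

text \<open>Zorn's lemma gives a minimal sublinear functional below \<open>p\<close>, and minimality
  forces linearity. No subspace is extended from: constraints on \<open>f\<close> are built into
  \<open>p\<close> beforehand by \<open>sublinear_inf_convolution\<close>.\<close>

lemma Hahn_Banach_sublinear:
  fixes p :: "'v::real_vector \<Rightarrow> real"
  assumes p: "sublinear p"
  obtains f where "linear f" "\<And>x. f x \<le> p x"
proof -
  define A where "A = {q. sublinear q \<and> q \<le> p}"
  \<comment> \<open>The order is reversed, so that a maximal element for \<open>R\<close> is a
    minimal functional and the bound of a chain is its pointwise infimum.\<close>
  define R where "R f g \<longleftrightarrow> g \<le> f" for f g :: "'v \<Rightarrow> real"
  have po: "partial_order_on A (relation_of R A)"
    by (rule partial_order_on_relation_ofI) (auto simp: R_def)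
  have bound: "\<exists>u\<in>A. \<forall>a\<in>C. R a u" if "C \<in> Chains (relation_of R A)" for C
  proof (cases "C = {}")
    case True
    then show ?thesis using p by (auto simp: A_def)
  next
    case False
    have CA: "C \<subseteq> A" and chain: "\<And>f g. f \<in> C \<Longrightarrow> g \<in> C \<Longrightarrow> f \<le> g \<or> g \<le> f"
      using that by (fastforce simp: Chains_def relation_of_def R_def)+
    then have sub: "\<And>q. q \<in> C \<Longrightarrow> sublinear q" and le: "\<And>q x. q \<in> C \<Longrightarrow> q x \<le> p x"
      by (auto simp: A_def le_fun_def)
    define u where "u x = (INF q\<in>C. q x)" for x
    have bdd: "bdd_below ((\<lambda>q. q x) ` C)" for x
    proof (rule bdd_belowI2)
      fix q assume "q \<in> C"
      then show "- p (- x) \<le> q x"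
        using sublinear_minus[OF sub, of q x] le[of q "- x"] by simp
    qed
    have lower: "u x \<le> q x" if "q \<in> C" for q x
      unfolding u_def by (rule cINF_lower[OF bdd that])
    have greatest: "b \<le> u x" if "\<And>q. q \<in> C \<Longrightarrow> b \<le> q x" for b x
      unfolding u_def using False that by (intro cINF_greatest) auto
    have "sublinear u"
    proof (rule sublinearI)
      fix x y
      have "u (x + y) - g y \<le> u x" if g: "g \<in> C" for g
      proof (rule greatest)
        fix f assume f: "f \<in> C"
        \<comment> \<open>Taking \<open>h\<close> as the smaller of \<open>f\<close> and
          \<open>g\<close> gives \<open>h (x + y) \<le> h x + h y \<le> f x + g y\<close>; this is
          where the chain property enters.\<close>
        obtain h where "h \<in> C" "h \<le> f" "h \<le> g"
          using chain[OF f g] f g by blast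
        then show "u (x + y) - g y \<le> f x"
          using lower[of h "x + y"] sublinear_add[OF sub, of h x y] by (smt (verit) le_funD)
      qed
      then have "u (x + y) - u x \<le> u y"
        by (intro greatest) (smt (verit))
      then show "u (x + y) \<le> u x + u y" by simp
    next
      fix r :: real and x assume r: "0 < r"
      have "u (r *\<^sub>R x) / r \<le> u x"
      proof (rule greatest)
        fix q assume "q \<in> C"
        then show "u (r *\<^sub>R x) / r \<le> q x"
          using lower[of q "r *\<^sub>R x"] r sublinear_scaleR[OF sub, of q r x] by (simp add: field_simps)
      qed
      then show "u (r *\<^sub>R x) \<le> r * u x"
        using r by (simp add: field_simps)
    qed
    moreover obtain q where "q \<in> C" using False by blast
    then have "u \<le> p"
      using lower[of q] le[of q] by (meson le_funI order_trans)
    ultimately have "u \<in> A" by (simp add: A_def)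
    then show ?thesis
      using lower by (auto simp: R_def le_fun_def)
  qed
  obtain f where f: "f \<in> A" "\<And>g. g \<in> A \<Longrightarrow> g \<le> f \<Longrightarrow> g = f"
    using predicate_Zorn[OF po bound] unfolding R_def by blast
  have "linear f"
  proof (rule minimal_sublinear_imp_linear)
    show "sublinear f" using f(1) by (simp add: A_def)
    fix q assume "sublinear q" "\<And>x. q x \<le> f x"
    then show "q = f"
      using f(1) by (intro f(2)) (auto simp: A_def le_fun_def intro: order_trans)
  qed
  with f(1) show ?thesis
    by (intro that[of f]) (auto simp: A_def le_fun_def)
qed

text \<open>Stands in for Hahn-Banach on the product of the \<open>F\<close>-indexed copies of \<open>'v\<close>, which is not a type
  when \<open>F\<close> is an arbitrary finite set.\<close>

lemma linear_dominated_by_sum: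
  fixes T :: "'k \<Rightarrow> 'u::real_vector \<Rightarrow> 'v::real_vector"
  assumes "finite F" and "\<And>k. k \<in> F \<Longrightarrow> linear (T k)" and "sublinear p" and "linear f"
    and "\<And>x. f x \<le> (\<Sum>k\<in>F. p (T k x))"
  shows "\<exists>g. (\<forall>k\<in>F. linear (g k) \<and> (\<forall>y. g k y \<le> p y)) \<and> (\<forall>x. f x = (\<Sum>k\<in>F. g k (T k x)))"
  using assms
proof (induction F arbitrary: f rule: finite_induct)
  case empty
  have "f x = 0" for x
    using empty(4)[of x] empty(4)[of "- x"] linear_neg[OF empty(3)] by simp
  then show ?case by simp
next
  case (insert k F)
  note p = \<open>sublinear p\<close> and f = \<open>linear f\<close>
  have Tk: "linear (T k)" and TF: "\<And>j. j \<in> F \<Longrightarrow> linear (T j)"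
    using insert.prems(1) by auto
  \<comment> \<open>\<open>c\<close> is the slack that the remaining maps leave for
    \<open>f\<close>. A linear \<open>h\<close> with \<open>- h (T k x) \<le> c x\<close> makes
    \<open>f - h o T k\<close> dominated by the sum over \<open>F\<close>, to which the induction
    hypothesis applies.\<close>
  define c where "c x = (\<Sum>j\<in>F. p (T j x)) - f x" for x
  have c_add: "c (x + y) \<le> c x + c y" for x y
  proof -
    have "(\<Sum>j\<in>F. p (T j (x + y))) \<le> (\<Sum>j\<in>F. p (T j x) + p (T j y))"
      by (rule sum_mono) (simp add: linear_add[OF TF] sublinear_add[OF p])
    then show ?thesis
      by (simp add: c_def linear_add[OF f] sum.distrib)
  qed
  have c_scale: "c (r *\<^sub>R x) = r * c x" if "0 \<le> r" for r x
    using that by (simp add: c_def linear_scale[OF f] linear_scale[OF TF] sublinear_scaleR[OF p]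
        right_diff_distrib sum_distrib_left)
  have c_pos: "0 \<le> p (T k x) + c x" for x
    using insert.prems(4)[of x] insert.hyps by (simp add: c_def)
  obtain q where q: "sublinear q" "\<And>y. q y \<le> p y" "\<And>x. x \<in> UNIV \<Longrightarrow> q (- T k x) \<le> c x"
    by (rule sublinear_inf_convolution[OF p Tk, where U=UNIV and c=c])
      (use c_add c_scale c_scale[of 0 0] c_pos in auto)
  obtain h where h: "linear h" "\<And>y. h y \<le> q y"
    by (rule Hahn_Banach_sublinear[OF q(1)]) (rule that)
  have "f x - h (T k x) \<le> (\<Sum>j\<in>F. p (T j x))" for x
    using h(2)[of "- T k x"] q(3)[of x] linear_neg[OF h(1)] by (simp add: c_def)
  moreover have "linear (\<lambda>x. f x - h (T k x))"
    by (intro linear_compose_sub f linear_compose[OF Tk h(1), unfolded o_def])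
  ultimately obtain g where g: "\<And>j. j \<in> F \<Longrightarrow> linear (g j) \<and> (\<forall>y. g j y \<le> p y)"
      "\<And>x. f x - h (T k x) = (\<Sum>j\<in>F. g j (T j x))"
    using insert.IH[OF TF p] by blast
  have "f x = (\<Sum>j\<in>insert k F. (g(k := h)) j (T j x))" for x
  proof -
    have "(\<Sum>j\<in>F. (g(k := h)) j (T j x)) = (\<Sum>j\<in>F. g j (T j x))"
      using insert.hyps by (intro sum.cong) auto
    then show ?thesis
      using insert.hyps g(2)[of x] by simp
  qed
  moreover have "h y \<le> p y" for y
    using h(2) q(2) by (rule order_trans)
  ultimately show ?case
    using g(1) h(1) by (intro exI[of _ "g(k := h)"]) simp
qed

section \<open>Separating a tuple from a joint range\<close>

text \<open>The functional \<open>d * snd z\<close> is dominated by the sum of the norms of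
  \<open>S k z\<close>, hence splits as a sum of \<open>g k (S k z)\<close>. Evaluation at
  \<open>(x, 0)\<close> shows that the \<open>g k\<close> annihilate the joint range; evaluation at
  \<open>(0, 1)\<close> shows that they sum to \<open>- d\<close> on the tuple
  \<open>y\<close>.\<close>

lemma separate_from_joint_range:
  fixes T :: "'k \<Rightarrow> 'u::real_vector \<Rightarrow> 'v::real_normed_vector"
  assumes F: "finite F" and T: "\<And>k. k \<in> F \<Longrightarrow> linear (T k)" and "0 < d"
    and far: "\<And>x. d \<le> (\<Sum>k\<in>F. norm (T k x - y k))"
  shows "\<exists>g :: 'k \<Rightarrow> 'v \<Rightarrow> real. (\<forall>k\<in>F. bounded_linear (g k)) \<and>
    (\<forall>x. (\<Sum>k\<in>F. g k (T k x)) = 0) \<and> (\<Sum>k\<in>F. g k (y k)) \<noteq> 0"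
proof -
  \<comment> \<open>Homogenise: the extra real coordinate turns the affine distances into seminorms.\<close>
  define S where "S k z = T k (fst z) - snd z *\<^sub>R y k" for k and z :: "'u \<times> real"
  have S: "linear (S k)" if "k \<in> F" for k
    unfolding S_def using linear_add[OF T[OF that]] linear_scale[OF T[OF that]]
    by (intro linearI) (simp_all add: algebra_simps)
  have f: "linear (\<lambda>z::'u \<times> real. d * snd z)"
    by (intro linearI) (simp_all add: algebra_simps)
  \<comment> \<open>For a positive last coordinate, dividing by it reduces the claim to
    \<open>far\<close>; otherwise the left side is at most 0.\<close>
  have dom: "d * snd z \<le> (\<Sum>k\<in>F. norm (S k z))" for z :: "'u \<times> real"
  proof (cases "snd z > 0")
    case True
    define t where "t = snd z"
    have t: "t > 0" using True by (simp add: t_def)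
    have "S k z = t *\<^sub>R (T k (inverse t *\<^sub>R fst z) - y k)" if "k \<in> F" for k
      using t linear_scale[OF T[OF that], of "inverse t" "fst z"]
      by (simp add: S_def t_def[symmetric] algebra_simps)
    then have "(\<Sum>k\<in>F. norm (S k z)) = t * (\<Sum>k\<in>F. norm (T k (inverse t *\<^sub>R fst z) - y k))"
      using t by (simp add: sum_distrib_left)
    also have "\<dots> \<ge> t * d"
      using t by (intro mult_left_mono far) simp
    finally show ?thesis by (simp add: t_def mult.commute)
  next
    case False
    then have "d * snd z \<le> 0"
      using \<open>0 < d\<close> by (simp add: mult_le_0_iff)
    then show ?thesis
      using sum_nonneg[of F "\<lambda>k. norm (S k z)"] by simp
  qed
  have "\<exists>g. (\<forall>k\<in>F. linear (g k) \<and> (\<forall>v. g k v \<le> norm v)) \<and> (\<forall>z. d * snd z = (\<Sum>k\<in>F. g k (S k z)))"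
    by (rule linear_dominated_by_sum[OF F S sublinear_norm f dom])
  then obtain g where "\<forall>k\<in>F. linear (g k) \<and> (\<forall>v. g k v \<le> norm v)"
      and "\<forall>z. d * snd z = (\<Sum>k\<in>F. g k (S k z))"
    by blast
  then have g: "\<And>k. k \<in> F \<Longrightarrow> linear (g k)" "\<And>k v. k \<in> F \<Longrightarrow> g k v \<le> norm v"
      "\<And>z. d * snd z = (\<Sum>k\<in>F. g k (S k z))"
    by blast+
  have "bounded_linear (g k)" if k: "k \<in> F" for k
  proof (rule bounded_linear_intro[where K=1])
    show "norm (g k v) \<le> norm v * 1" for v
      using g(2)[OF k, of v] g(2)[OF k, of "- v"] linear_neg[OF g(1)[OF k], of v] by simp
  qed (use g(1)[OF k] in \<open>simp_all add: linear_add linear_scale\<close>)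
  moreover have "(\<Sum>k\<in>F. g k (T k x)) = 0" for x
    using g(3)[of "(x, 0)"] by (simp add: S_def)
  moreover have "(\<Sum>k\<in>F. g k (y k)) \<noteq> 0"
  proof -
    have "d = (\<Sum>k\<in>F. g k (- y k))"
      using g(3)[of "(0, 1)"] linear_0[OF T] by (simp add: S_def)
    also have "\<dots> = - (\<Sum>k\<in>F. g k (y k))"
      using linear_neg[OF g(1)] by (simp add: sum_negf)
    finally show ?thesis using \<open>0 < d\<close> by auto
  qed
  ultimately show ?thesis by blast
qed

section \<open>Complex functionals and their real parts\<close>

lemma bounded_linear_scaleC: "bounded_linear ((*\<^sub>C) c :: 'x::complex_normed_vector \<Rightarrow> 'x)"
  by (rule bounded_linear_intro[where K="cmod c"])
    (simp_all add: scaleC_add_right scaleR_scaleC scaleC_scaleC norm_scaleC mult.commute)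

text \<open>The separating functionals are real, while a bidual element acts on complex ones. A
  complex linear \<open>f\<close> is recovered from its real part \<open>g\<close> by
  \<open>f x = g x - \<i> g (\<i> x)\<close>.\<close>

lemma dual_with_real_part:
  fixes g :: "'x::complex_normed_vector \<Rightarrow> real"
  assumes g: "bounded_linear g"
  obtains f :: "'x dual" where "\<And>x. Re (dual_apply f x) = g x"
proof -
  interpret g: bounded_linear g by (rule g)
  define h where "h x = complex_of_real (g x) - \<i> * complex_of_real (g (\<i> *\<^sub>C x))" for x
  \<comment> \<open>This reduces complex homogeneity of \<open>h\<close> to real linearity of
    \<open>g\<close> at \<open>x\<close> and \<open>\<i> *\<^sub>C x\<close>.\<close>
  have scale: "c *\<^sub>C x = Re c *\<^sub>R x + Im c *\<^sub>R (\<i> *\<^sub>C x)" for c and x :: 'x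
    by (subst complex_eq) (simp add: scaleC_add_left scaleR_scaleC scaleC_scaleC mult.commute)
  have "bounded_linear h"
    unfolding h_def
    by (intro bounded_linear_sub bounded_linear_compose[OF bounded_linear_of_real g]
        bounded_linear_compose[OF bounded_linear_mult_right]
        bounded_linear_compose[OF bounded_linear_of_real bounded_linear_compose[OF g bounded_linear_scaleC]])
  moreover have "h (c *\<^sub>C x) = c *\<^sub>C h x" for c x
  proof -
    have 1: "g (c *\<^sub>C x) = Re c * g x + Im c * g (\<i> *\<^sub>C x)"
      by (subst scale) (simp add: g.add g.scaleR)
    have "\<i> *\<^sub>C c *\<^sub>C x = c *\<^sub>C \<i> *\<^sub>C x"
      by (simp add: scaleC_scaleC mult.commute)
    also have "\<dots> = Re c *\<^sub>R (\<i> *\<^sub>C x) - Im c *\<^sub>R x"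
      by (subst scale) (simp add: scaleC_scaleC scaleC_minus_one)
    finally have 2: "g (\<i> *\<^sub>C c *\<^sub>C x) = Re c * g (\<i> *\<^sub>C x) - Im c * g x"
      by (simp add: g.diff g.scaleR)
    show ?thesis
      unfolding h_def 1 2 scaleC_complex_def by (simp add: complex_eq_iff)
  qed
  ultimately have "bounded_clinear h"
    by (simp add: bounded_clinear_def)
  then have "Re (dual_apply (Dual h) x) = g x" for x
    by (simp add: Dual_inverse h_def)
  then show ?thesis by (rule that)
qed

text \<open>The imaginary part at \<open>x\<close> is minus the real part at
  \<open>\<i> *\<^sub>C x\<close>.\<close>

lemma dual_eq_0_if_Re:
  fixes f :: "'x::complex_normed_vector dual"
  assumes Re: "\<And>x. Re (dual_apply f x) = 0"
  shows "f = 0"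
proof (rule dual_eqI)
  fix x
  have "dual_apply f (\<i> *\<^sub>C x) = \<i> * dual_apply f x"
    using bounded_clinear_dual_apply[of f] by (simp add: bounded_clinear_def scaleC_complex_def)
  then have "Im (dual_apply f x) = 0"
    using Re[of "\<i> *\<^sub>C x"] by simp
  then show "dual_apply f x = dual_apply 0 x"
    using Re[of x] by (simp add: complex_eq_iff zero_dual.rep_eq)
qed

lemma dual_apply_sum: "dual_apply (\<Sum>k\<in>F. f k) x = (\<Sum>k\<in>F. dual_apply (f k) x)"
  by (induction F rule: infinite_finite_induct) (simp_all add: zero_dual.rep_eq plus_dual.rep_eq)

lemma bounded_linear_dual_apply: "bounded_linear (dual_apply f)"
  using bounded_clinear_dual_apply bounded_clinear_def by blast

lemma tendsto_dual_apply:
  assumes "(f \<longlongrightarrow> l) N"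
  shows "((\<lambda>i. dual_apply (f i) x) \<longlongrightarrow> dual_apply l x) N"
proof (rule LIM_zero_cancel, rule Lim_null_comparison)
  show "\<forall>\<^sub>F i in N. norm (dual_apply (f i) x - dual_apply l x) \<le> norm (f i - l) * norm x"
    using norm_dual_apply_le[of "f _ - l" x] by (simp add: minus_dual.rep_eq)
  show "((\<lambda>i. norm (f i - l) * norm x) \<longlongrightarrow> 0) N"
    by (rule tendsto_mult_left_zero) (rule tendsto_norm_zero[OF LIM_zero[OF assms]])
qed

lemma bounded_clinear_mult_left: "bounded_clinear (\<lambda>x. x * (a::'a::complex_banach_algebra))"
  by (simp add: bounded_clinear_def bounded_linear_mult_left mult_scaleC_left)

section \<open>From the bidual to the tensor product\<close>

text \<open>If no \<open>t\<close> works, some functional separates \<open>(0, a)\<close> from the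
  values of \<open>T\<close>. Its pullback to the tensor product is 0, so each \<open>m i\<close>
  sends it to 0; yet along \<open>N\<close> these values tend to its nonzero value at the
  target.\<close>

lemma approximate_diagonal_of_bidual_net:
  fixes m :: "'i \<Rightarrow> ('a::complex_banach_algebra, 'a) proj_tensor dual dual" and F :: "'a set"
  assumes N: "N \<noteq> bot" and F: "finite F" and e: "0 < e"
    and comm: "\<And>a. ((\<lambda>i. bidual_left tensor_left a (m i) - bidual_right tensor_right a (m i)) \<longlongrightarrow> 0) N"
    and unit: "\<And>a. ((\<lambda>i. bidual_right (\<lambda>a x. x * a) a (adjoint (adjoint tensor_mult) (m i)))
          \<longlongrightarrow> canonical_embedding a) N"
  shows "\<exists>t. \<forall>a\<in>F. norm (tensor_left a t - tensor_right a t) < e \<and> norm (tensor_mult t * a - a) < e"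
proof (rule ccontr)
  assume no: "\<not> ?thesis"
  note bcl = bounded_clinear_tensor_left bounded_clinear_tensor_right bounded_clinear_tensor_mult
    bounded_clinear_mult_left bounded_clinear_adjoint
  define T where "T a t = (tensor_left a t - tensor_right a t, tensor_mult t * a)" for a :: 'a and t
  have "bounded_linear (T a)" for a
    unfolding T_def
    by (intro bounded_linear_Pair bounded_linear_sub bounded_linear_compose[OF bounded_linear_mult_left]
        bcl[unfolded bounded_clinear_def, THEN conjunct1])
  then have T: "linear (T a)" for a
    by (rule bounded_linear.linear)
  \<comment> \<open>A single bad component already has norm at least \<open>e\<close>, and it is
    bounded by the norm of its pair and then by the whole sum.\<close>
  have far: "e \<le> (\<Sum>a\<in>F. norm (T a t - (0, a)))" for t
  proof -
    obtain a where a: "a \<in> F"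
      "e \<le> norm (tensor_left a t - tensor_right a t) \<or> e \<le> norm (tensor_mult t * a - a)"
      using no by (meson not_less)
    then have "e \<le> norm (T a t - (0, a))"
      unfolding T_def by (auto intro: order_trans[OF _ norm_fst_le] order_trans[OF _ norm_snd_le])
    also have "\<dots> \<le> (\<Sum>a\<in>F. norm (T a t - (0, a)))"
      by (rule member_le_sum[OF a(1) _ F]) simp
    finally show ?thesis .
  qed
  have "\<exists>\<phi>. (\<forall>a\<in>F. bounded_linear (\<phi> a)) \<and> (\<forall>t. (\<Sum>a\<in>F. \<phi> a (T a t)) = 0) \<and> (\<Sum>a\<in>F. \<phi> a (0, a)) \<noteq> (0::real)"
    by (rule separate_from_joint_range[OF F T e far])
  then obtain \<phi> where \<phi>: "\<And>a. a \<in> F \<Longrightarrow> bounded_linear (\<phi> a)" "\<And>t. (\<Sum>a\<in>F. \<phi> a (T a t)) = 0"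
      "(\<Sum>a\<in>F. \<phi> a (0, a)) \<noteq> (0::real)"
    by blast
  \<comment> \<open>Restricting \<open>\<phi> a\<close> to each coordinate gives real functionals on
    the tensor product and on the algebra; \<open>g a\<close> and \<open>h a\<close> are complex
    functionals with these real parts.\<close>
  have "\<exists>g. \<forall>x. Re (dual_apply g x) = \<phi> a (x, 0)" if "a \<in> F" for a
    using dual_with_real_part[OF bounded_linear_compose[OF \<phi>(1)[OF that]
        bounded_linear_Pair[OF bounded_linear_ident bounded_linear_zero]]] by metis
  then obtain g where g: "\<And>a x. a \<in> F \<Longrightarrow> Re (dual_apply (g a) x) = \<phi> a (x, 0)"
    by metis
  have "\<exists>h. \<forall>x. Re (dual_apply h x) = \<phi> a (0, x)" if "a \<in> F" for a
    using dual_with_real_part[OF bounded_linear_compose[OF \<phi>(1)[OF that]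
        bounded_linear_Pair[OF bounded_linear_zero bounded_linear_ident]]] by metis
  then obtain h where h: "\<And>a x. a \<in> F \<Longrightarrow> Re (dual_apply (h a) x) = \<phi> a (0, x)"
    by metis
  \<comment> \<open>The pullback of the pair \<open>g a\<close>, \<open>h a\<close> along
    \<open>T a\<close>, written with adjoints so that it can be fed to \<open>m i\<close>.\<close>
  define G where "G a = adjoint (tensor_left a) (g a) - adjoint (tensor_right a) (g a) +
    adjoint tensor_mult (adjoint (\<lambda>x. x * a) (h a))" for a
  have G_apply: "dual_apply (G a) t =
      dual_apply (g a) (tensor_left a t - tensor_right a t) + dual_apply (h a) (tensor_mult t * a)" for a t
    by (simp add: G_def plus_dual.rep_eq minus_dual.rep_eq dual_apply_adjoint bcl
        bounded_linear.linear[OF bounded_linear_dual_apply, THEN linear_diff])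
  have "(\<Sum>a\<in>F. G a) = 0"
  proof (rule dual_eq_0_if_Re)
    fix t
    have "Re (dual_apply (G a) t) = \<phi> a (T a t)" if "a \<in> F" for a
      using linear_add[OF bounded_linear.linear[OF \<phi>(1)[OF that]],
          of "(tensor_left a t - tensor_right a t, 0)" "(0, tensor_mult t * a)"]
      by (simp add: G_apply g h that T_def)
    then show "Re (dual_apply (\<Sum>a\<in>F. G a) t) = 0"
      using \<phi>(2)[of t] by (simp add: dual_apply_sum)
  qed
  \<comment> \<open>Only the sum over \<open>F\<close> vanishes, not each \<open>G a\<close>; hence
    the whole finite set has to be treated at once.\<close>
  then have mG: "(\<Sum>a\<in>F. dual_apply (m i) (G a)) = 0" for i
    using bounded_linear.linear[OF bounded_linear_dual_apply[of "m i"]]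
    by (metis linear_0 linear_sum)
  \<comment> \<open>The bidual actions are double adjoints, so each adjoint in \<open>G a\<close>
    moves across the pairing onto \<open>m i\<close>.\<close>
  have "dual_apply (m i) (G a) =
      dual_apply (bidual_left tensor_left a (m i) - bidual_right tensor_right a (m i)) (g a) +
      dual_apply (bidual_right (\<lambda>a x. x * a) a (adjoint (adjoint tensor_mult) (m i))) (h a)" for a i
    using bounded_linear.linear[OF bounded_linear_dual_apply[of "m i"]]
    by (simp add: G_def linear_add linear_diff minus_dual.rep_eq bidual_left_def bidual_right_def
        dual_left_def dual_right_def dual_apply_adjoint bcl)
  then have "((\<lambda>i. \<Sum>a\<in>F. dual_apply (m i) (G a)) \<longlongrightarrow>
      (\<Sum>a\<in>F. dual_apply 0 (g a) + dual_apply (canonical_embedding a) (h a))) N"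
    by (simp only:) (intro tendsto_sum tendsto_add tendsto_dual_apply comm unit)
  \<comment> \<open>By \<open>mG\<close> the net is constantly 0, and limits along \<open>N\<close>
    are unique because \<open>N \<noteq> bot\<close>.\<close>
  then have "(\<Sum>a\<in>F. dual_apply (h a) a) = 0"
    using tendsto_unique[OF N _ tendsto_const]
    by (fastforce simp: mG zero_dual.rep_eq dual_apply_canonical_embedding)
  then have "(\<Sum>a\<in>F. Re (dual_apply (h a) a)) = 0"
    by (simp flip: Re_sum)
  then show False
    using \<phi>(3) h by simp
qed

theorem proposition2p1:
  assumes "strong_pseudo_amenable TYPE('i) TYPE('a::complex_banach_algebra)"
  shows "pseudo_amenable TYPE('a set \<times> nat) TYPE('a)"
proof -
  obtain I :: "'i set" and le and m :: "'i \<Rightarrow> ('a, 'a) proj_tensor dual dual" where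
    I: "directed_set I le" and
    comm: "\<And>a. ((\<lambda>i. bidual_left tensor_left a (m i) - bidual_right tensor_right a (m i)) \<longlongrightarrow> 0) (tails I le)" and
    unit: "\<And>a. ((\<lambda>i. bidual_right (\<lambda>a x. x * a) a (adjoint (adjoint tensor_mult) (m i)))
          \<longlongrightarrow> canonical_embedding a) (tails I le)"
    using assms unfolding strong_pseudo_amenable_def by blast
  \<comment> \<open>The tolerance uses \<open>Suc n\<close> so that it is positive at
    \<open>n = 0\<close> too and matches \<open>tails_finset_tendstoI\<close>.\<close>
  define good where "good F n t \<longleftrightarrow> (\<forall>a\<in>F. norm (tensor_left a t - tensor_right a t) < 1 / real (Suc n) \<and>
      norm (tensor_mult t * a - a) < 1 / real (Suc n))" for F :: "'a set" and n t
  \<comment> \<open>One choice for each finite set and accuracy turns the approximations into a net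
    indexed by these pairs; its norms need not be bounded.\<close>
  define t where "t F n = (SOME t. good F n t)" for F n
  have t: "good F n (t F n)" if "finite F" for F n
    unfolding t_def good_def
    by (rule someI_ex, rule approximate_diagonal_of_bidual_net[OF tails_neq_bot[OF I] that _ comm unit]) simp
  show ?thesis
    unfolding pseudo_amenable_def
  proof (intro exI conjI allI)
    fix a :: 'a
    show "((\<lambda>p. tensor_left a (t (fst p) (snd p)) - tensor_right a (t (fst p) (snd p))) \<longlongrightarrow> 0)
        (tails {p. finite (fst p)} finset_le)"
      and "((\<lambda>p. tensor_mult (t (fst p) (snd p)) * a) \<longlongrightarrow> a) (tails {p. finite (fst p)} finset_le)"
      by (rule tails_finset_tendstoI[where a=a], use t in \<open>auto simp only: good_def dist_norm diff_zero fst_conv snd_conv\<close>)+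
  qed (rule directed_finset_le)
qed

end
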